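(* Let $(\Sigma,\sigma,\tau)$ be a non-separating real curve with an involution, and let $\{a_j,b_j\}$ be a $\sigma$-invariant real basis of cycles as in the context, with Prym matrix $\Pi$. Denote by $\Pi_q\in\mathbb{C}^h$ the $q$-th column of $\Pi$ and by $A_q\in\mathbb{C}^h$ the $q$-th column of $2\pi \mathrm{i}E$ ($E$ the unit $h\times h$ matrix). Then: $1^\circ$. $\overline{\Pi_\beta}=\Pi_\beta$ for $\beta=1,\dots,r_0$; $2^\circ$. $\overline{\Pi_j}=\Pi_j$ for $j=g_\sigma+1,\dots,g_\sigma+r_1$; $3^\circ$. $\overline{\Pi_\beta}=\Pi_\beta-A_\beta$ for $\beta=r_0+1,\dots,g_\sigma$; $4^\circ$. $\overline{\Pi_j}=\Pi_j-\frac12A_j$ for $j=g_\sigma+r_1+1,\dots,h$.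
   Context: A real curve with an involution is a compact nonsingular connected algebraic curve $\Sigma$ over $\mathbb{C}$ (a compact Riemann surface) of genus $g$ with two commuting involutions: $\sigma$ holomorphic and $\tau$ antiholomorphic. Ovals are the connected components of the fixed point set of $\tau$; $(\Sigma,\tau)$ is non-separating if $\Sigma\setminus\bigcup\text{ovals}$ is connected. Let $\Sigma_\sigma=\Sigma/\sigma$ have genus $g_\sigma$, let $\Sigma\to\Sigma_\sigma$ have branch divisor of degree $2n$ ($n\ge 1$), and $h=g_\sigma+n-1$, so $g=h+g_\sigma$. Basis: $\{a_j,b_j\}_{j=1}^g$ is a symplectic basis of $H_1(\Sigma,\mathbb{Z})$ with $\sigma(a_j)=-a_{s(j)}$, $\sigma(b_j)=-b_{s(j)}$, where $s$ is the permutation $(1,h+1)\cdots(g_\sigma,h+g_\sigma)(g_\sigma+1)\cdots(h)$. It is also real with respect to $\tau$ (up to labelling of the cycles): $\tau(a_j)=a_j$ for all $j$; $\tau(b_j)=-b_j$ for those $j$ for which $a_j$ is an "oval" of the basis, and $\tau(b_j)=-b_j+a_j$ for the other $j$ ("non-ovals"). Among indices $1,\dots,h$ the ovals are exactly $a_1,\dots,a_{r_0}$ and $a_{g_\sigma+1},\dots,a_{g_\sigma+r_1}$ ($r_0\le g_\sigma$, $r_1\le n-1$). Differentials: $w_1,\dots,w_g$ are the holomorphic differentials with $\int_{a_j}w_i=2\pi \mathrm{i}\,\delta_{ij}$. The normalized Prym differentials are $\omega_i=w_i+w_{i+h}$ for $1\le i\le g_\sigma$ and $\omega_i=w_i$ for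 $g_\sigma<i\le h$. The Prym matrix $\Pi$ is the $h\times h$ matrix with $\Pi_{ij}=\int_{b_j}\omega_i$ for $j\le g_\sigma$ and $\Pi_{ij}=\frac12\int_{b_j}\omega_i$ for $g_\sigma<j\le h$. Bars denote complex conjugation. *)

theory Defs
  imports
    "HOL-Homology.Homology"
    "HOL-Complex_Analysis.Complex_Analysis"
    "HOL-Library.Function_Algebras"
begin

section \<open>Riemann surfaces and their maps\<close>

type_synonym 'a chart = "'a set \<times> ('a \<Rightarrow> complex)"

record 'a surface =
  stop :: "'a topology"
  atlas :: "'a chart set"

abbreviation points :: "'a surface \<Rightarrow> 'a set" where
  "points S \<equiv> topspace (stop S)"

definition complex_chart :: "'a topology \<Rightarrow> 'a chart \<Rightarrow> bool" where
  "complex_chart X = (\<lambda>(U, \<phi>). openin X U \<and> open (\<phi> ` U) \<and>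
     homeomorphic_map (subtopology X U) (top_of_set (\<phi> ` U)) \<phi>)"

definition riemann_surface :: "'a surface \<Rightarrow> bool" where
  "riemann_surface S \<longleftrightarrow>
     Hausdorff_space (stop S) \<and> points S \<noteq> {} \<and> connected_space (stop S) \<and>
     (\<forall>c\<in>atlas S. complex_chart (stop S) c) \<and> (\<Union>(U, \<phi>)\<in>atlas S. U) = points S \<and>
     (\<forall>(U, \<phi>)\<in>atlas S. \<forall>(V, \<psi>)\<in>atlas S. (\<psi> \<circ> inv_into U \<phi>) holomorphic_on \<phi> ` (U \<inter> V))"

definition compact_riemann_surface :: "'a surface \<Rightarrow> bool" where
  "compact_riemann_surface S \<longleftrightarrow> riemann_surface S \<and> compact_space (stop S)"

definition holomorphic_map :: "'a surface \<Rightarrow> 'b surface \<Rightarrow> ('a \<Rightarrow> 'b) \<Rightarrow> bool" where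
  "holomorphic_map S T f \<longleftrightarrow> continuous_map (stop S) (stop T) f \<and>
     (\<forall>(U, \<phi>)\<in>atlas S. \<forall>(V, \<psi>)\<in>atlas T.
        (\<psi> \<circ> f \<circ> inv_into U \<phi>) holomorphic_on \<phi> ` {p\<in>U. f p \<in> V})"

definition antiholomorphic_map :: "'a surface \<Rightarrow> 'b surface \<Rightarrow> ('a \<Rightarrow> 'b) \<Rightarrow> bool" where
  "antiholomorphic_map S T f \<longleftrightarrow> continuous_map (stop S) (stop T) f \<and>
     (\<forall>(U, \<phi>)\<in>atlas S. \<forall>(V, \<psi>)\<in>atlas T.
        (cnj \<circ> \<psi> \<circ> f \<circ> inv_into U \<phi>) holomorphic_on \<phi> ` {p\<in>U. f p \<in> V})"

definition involution_on :: "'a set \<Rightarrow> ('a \<Rightarrow> 'a) \<Rightarrow> bool" where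
  "involution_on A f \<longleftrightarrow> f ` A \<subseteq> A \<and> (\<forall>p\<in>A. f (f p) = p) \<and> (\<exists>p\<in>A. f p \<noteq> p)"

definition real_curve_with_involution :: "'a surface \<Rightarrow> ('a \<Rightarrow> 'a) \<Rightarrow> ('a \<Rightarrow> 'a) \<Rightarrow> bool" where
  "real_curve_with_involution S \<sigma> \<tau> \<longleftrightarrow> compact_riemann_surface S \<and>
     holomorphic_map S S \<sigma> \<and> involution_on (points S) \<sigma> \<and>
     antiholomorphic_map S S \<tau> \<and> involution_on (points S) \<tau> \<and>
     (\<forall>p\<in>points S. \<sigma> (\<tau> p) = \<tau> (\<sigma> p))"

definition real_ovals :: "'a surface \<Rightarrow> ('a \<Rightarrow> 'a) \<Rightarrow> 'a set set" where
  "real_ovals S \<tau> = connected_components_of (subtopology (stop S) {p\<in>points S. \<tau> p = p})"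

definition non_separating :: "'a surface \<Rightarrow> ('a \<Rightarrow> 'a) \<Rightarrow> bool" where
  "non_separating S \<tau> \<longleftrightarrow>
     connected_space (subtopology (stop S) (points S - \<Union>(real_ovals S \<tau>)))"

section \<open>Holomorphic differentials and genus\<close>

text \<open>A holomorphic differential is recorded by its coefficient functions: \<open>\<omega> (U, \<phi>)\<close> is the
  function \<open>f\<close> with \<open>\<omega> = f(z) dz\<close> in the coordinate \<open>z = \<phi> p\<close>. The coefficients are normalized
  to vanish where they carry no information, so that equality of differentials is equality of
  functions and the dimension below is the right one.\<close>

type_synonym 'a differential = "'a chart \<Rightarrow> complex \<Rightarrow> complex"

definition holomorphic_differentials :: "'a surface \<Rightarrow> 'a differential set" where
  "holomorphic_differentials S = {\<omega>.
     (\<forall>c. c \<notin> atlas S \<longrightarrow> \<omega> c = (\<lambda>z. 0)) \<and>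
     (\<forall>(U, \<phi>)\<in>atlas S. \<omega> (U, \<phi>) holomorphic_on \<phi> ` U \<and> (\<forall>z. z \<notin> \<phi> ` U \<longrightarrow> \<omega> (U, \<phi>) z = 0)) \<and>
     (\<forall>(U, \<phi>)\<in>atlas S. \<forall>(V, \<psi>)\<in>atlas S. \<forall>p\<in>U \<inter> V.
        \<omega> (U, \<phi>) (\<phi> p) = \<omega> (V, \<psi>) (\<psi> p) * deriv (\<psi> \<circ> inv_into U \<phi>) (\<phi> p))}"

definition scale_differential :: "complex \<Rightarrow> 'a differential \<Rightarrow> 'a differential" where
  "scale_differential k \<omega> = (\<lambda>c z. k * \<omega> c z)"

lemma vector_space_differentials: "vector_space scale_differential"
  by unfold_locales (auto simp: scale_differential_def fun_eq_iff algebra_simps)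

definition genus :: "'a surface \<Rightarrow> nat" where
  "genus S = vector_space.dim scale_differential (holomorphic_differentials S)"

section \<open>The quotient by an involution and its branch divisor\<close>

definition orbit_map :: "('a \<Rightarrow> 'a) \<Rightarrow> 'a \<Rightarrow> 'a set" where
  "orbit_map \<sigma> p = {p, \<sigma> p}"

definition quotient_top :: "'a topology \<Rightarrow> ('a \<Rightarrow> 'b) \<Rightarrow> 'b topology" where
  "quotient_top X f =
     topology (\<lambda>W. W \<subseteq> f ` topspace X \<and> openin X {p\<in>topspace X. f p \<in> W})"

lemma openin_quotient_top:
  "openin (quotient_top X f) W \<longleftrightarrow>
     W \<subseteq> f ` topspace X \<and> openin X {p\<in>topspace X. f p \<in> W}"
proof -
  have "istopology (\<lambda>W. W \<subseteq> f ` topspace X \<and> openin X {p\<in>topspace X. f p \<in> W})"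
    unfolding istopology_def
  proof safe
    fix A B
    assume "openin X {p\<in>topspace X. f p \<in> A}" "openin X {p\<in>topspace X. f p \<in> B}"
    moreover have "{p\<in>topspace X. f p \<in> A \<inter> B} =
        {p\<in>topspace X. f p \<in> A} \<inter> {p\<in>topspace X. f p \<in> B}" by auto
    ultimately show "openin X {p\<in>topspace X. f p \<in> A \<inter> B}" by auto
  next
    fix \<K>
    assume "\<forall>K\<in>\<K>. K \<subseteq> f ` topspace X \<and> openin X {p\<in>topspace X. f p \<in> K}"
    moreover have "{p\<in>topspace X. f p \<in> \<Union>\<K>} = (\<Union>K\<in>\<K>. {p\<in>topspace X. f p \<in> K})" by auto
    ultimately show "openin X {p\<in>topspace X. f p \<in> \<Union>\<K>}" by auto
  qed blast+
  then show ?thesis by (simp add: quotient_top_def)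
qed

text \<open>The quotient \<open>S/\<sigma>\<close> of a Riemann surface by a holomorphic involution. Its charts are all
  complex coordinates whose pullback to \<open>S\<close> is holomorphic; near the image of a fixed point of
  \<open>\<sigma>\<close> where \<open>\<sigma>\<close> is \<open>z \<mapsto> -z\<close> the coordinate \<open>z^2\<close> is one of them.\<close>

definition quotient_surface :: "'a surface \<Rightarrow> ('a \<Rightarrow> 'a) \<Rightarrow> 'a set surface" where
  "quotient_surface S \<sigma> = \<lparr>
     stop = quotient_top (stop S) (orbit_map \<sigma>),
     atlas = {(V, \<psi>). complex_chart (quotient_top (stop S) (orbit_map \<sigma>)) (V, \<psi>) \<and>
       (\<forall>(U, \<phi>)\<in>atlas S.
          (\<psi> \<circ> orbit_map \<sigma> \<circ> inv_into U \<phi>) holomorphic_on \<phi> ` {p\<in>U. orbit_map \<sigma> p \<in> V})}\<rparr>"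

definition ramification_index :: "'a surface \<Rightarrow> 'b surface \<Rightarrow> ('a \<Rightarrow> 'b) \<Rightarrow> 'a \<Rightarrow> int" where
  "ramification_index S T f p = (THE e. \<forall>(U, \<phi>)\<in>atlas S. \<forall>(V, \<psi>)\<in>atlas T.
     p \<in> U \<longrightarrow> f p \<in> V \<longrightarrow> zorder (\<lambda>z. \<psi> (f (inv_into U \<phi> z)) - \<psi> (f p)) (\<phi> p) = e)"

definition branch_divisor :: "'a surface \<Rightarrow> 'b surface \<Rightarrow> ('a \<Rightarrow> 'b) \<Rightarrow> 'b \<Rightarrow> int" where
  "branch_divisor S T f q = (\<Sum>p | p \<in> points S \<and> f p = q. ramification_index S T f p - 1)"

definition divisor_degree :: "'a surface \<Rightarrow> ('a \<Rightarrow> int) \<Rightarrow> int" where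
  "divisor_degree S D = (\<Sum>p | p \<in> points S \<and> D p \<noteq> 0. D p)"

section \<open>Integration over homology classes\<close>

abbreviation H1 :: "'a surface \<Rightarrow> 'a chain set monoid" where
  "H1 S \<equiv> homology_group 1 (stop S)"

abbreviation H1_map :: "'a surface \<Rightarrow> ('a \<Rightarrow> 'a) \<Rightarrow> 'a chain set \<Rightarrow> 'a chain set" where
  "H1_map S f \<equiv> hom_induced 1 (stop S) {} (stop S) {} f"

text \<open>Singular simplices are merely continuous, so holomorphic differentials are integrated along
  them by continuing local primitives: \<open>F\<close> is a primitive of \<open>\<omega>\<close> along \<open>\<gamma>\<close> if near every time \<open>t\<close>
  it is \<open>P \<circ> \<phi> \<circ> \<gamma>\<close> for a chart \<open>\<phi>\<close> around \<open>\<gamma> t\<close> and a primitive \<open>P\<close> of the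
  coefficient of \<open>\<omega>\<close> in that chart. For piecewise smooth \<open>\<gamma>\<close>, \<open>F 1 - F 0\<close> is the usual integral.\<close>

definition primitive_along ::
    "'a surface \<Rightarrow> 'a differential \<Rightarrow> (real \<Rightarrow> 'a) \<Rightarrow> (real \<Rightarrow> complex) \<Rightarrow> bool" where
  "primitive_along S \<omega> \<gamma> F \<longleftrightarrow> (\<forall>t\<in>{0..1}. \<exists>(U, \<phi>)\<in>atlas S. \<exists>W P e.
     \<gamma> t \<in> U \<and> open W \<and> W \<subseteq> \<phi> ` U \<and> (\<forall>z\<in>W. (P has_field_derivative \<omega> (U, \<phi>) z) (at z)) \<and>
     e > 0 \<and> (\<forall>s\<in>{0..1}. \<bar>s - t\<bar> < e \<longrightarrow> \<gamma> s \<in> U \<and> \<phi> (\<gamma> s) \<in> W \<and> F s = P (\<phi> (\<gamma> s))))"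

definition path_integral :: "'a surface \<Rightarrow> 'a differential \<Rightarrow> (real \<Rightarrow> 'a) \<Rightarrow> complex" where
  "path_integral S \<omega> \<gamma> = (THE I. \<exists>F. primitive_along S \<omega> \<gamma> F \<and> I = F 1 - F 0)"

text \<open>The parametrization of the standard 1-simplex from vertex 0 to vertex 1, in accordance with
  the boundary \<open>f (vertex 1) - f (vertex 0)\<close> of a singular 1-simplex \<open>f\<close>.\<close>

definition edge_path :: "real \<Rightarrow> nat \<Rightarrow> real" where
  "edge_path t = (\<lambda>i. if i = 0 then 1 - t else if i = 1 then t else 0)"

definition chain_integral :: "'a surface \<Rightarrow> 'a differential \<Rightarrow> 'a chain \<Rightarrow> complex" where
  "chain_integral S \<omega> c =
     (\<Sum>f\<in>Poly_Mapping.keys c. of_int (poly_mapping.lookup c f) * path_integral S \<omega> (f \<circ> edge_path))"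

text \<open>An element of \<open>H1 S\<close> is a set of mutually homologous cycles.\<close>

definition period :: "'a surface \<Rightarrow> 'a chain set \<Rightarrow> 'a differential \<Rightarrow> complex" where
  "period S C \<omega> = (THE I. \<forall>c\<in>C. chain_integral S \<omega> c = I)"

section \<open>Intersection numbers and symplectic bases\<close>

text \<open>Smooth closed curves, as 1-periodic maps on the real line.\<close>

definition smooth_loop :: "'a surface \<Rightarrow> (real \<Rightarrow> 'a) \<Rightarrow> bool" where
  "smooth_loop S \<gamma> \<longleftrightarrow> continuous_map euclideanreal (stop S) \<gamma> \<and> (\<forall>t. \<gamma> (t + 1) = \<gamma> t) \<and>
     (\<forall>(U, \<phi>)\<in>atlas S. \<exists>D. continuous_on {t. \<gamma> t \<in> U} D \<and>
        (\<forall>t. \<gamma> t \<in> U \<longrightarrow> ((\<phi> \<circ> \<gamma>) has_vector_derivative D t) (at t)))"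

definition loop_class :: "'a surface \<Rightarrow> (real \<Rightarrow> 'a) \<Rightarrow> 'a chain set" where
  "loop_class S \<gamma> =
     homologous_rel_set 1 (stop S) {} (frag_of (restrict (\<lambda>x. \<gamma> (x 1)) (standard_simplex 1)))"

text \<open>Every class in \<open>H1 S\<close> is the class of a smooth loop, and two classes have representing loops
  that meet transversally. Their intersection number is the number of crossings, counted with sign
  \<open>+1\<close> if the two tangent vectors form a positively oriented frame for the complex orientation,
  that is, if \<open>Im (cnj u * v) > 0\<close> for their coordinates \<open>u\<close>, \<open>v\<close> in any chart; it does not depend
  on the loops.\<close>

definition has_intersection_number ::
    "'a surface \<Rightarrow> 'a chain set \<Rightarrow> 'a chain set \<Rightarrow> int \<Rightarrow> bool" where
  "has_intersection_number S A B k \<longleftrightarrow> (\<exists>\<alpha> \<beta> \<epsilon>.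
     smooth_loop S \<alpha> \<and> smooth_loop S \<beta> \<and> loop_class S \<alpha> = A \<and> loop_class S \<beta> = B \<and>
     (let Z = {(s, t). s \<in> {0..<1} \<and> t \<in> {0..<1} \<and> \<alpha> s = \<beta> t} in
        finite Z \<and>
        (\<forall>(s, t)\<in>Z. \<forall>(U, \<phi>)\<in>atlas S. \<alpha> s \<in> U \<longrightarrow>
           (let d = Im (cnj (vector_derivative (\<phi> \<circ> \<alpha>) (at s)) * vector_derivative (\<phi> \<circ> \<beta>) (at t))
            in d \<noteq> 0 \<and> of_int (\<epsilon> (s, t)) = sgn d)) \<and>
        k = (\<Sum>z\<in>Z. \<epsilon> z)))"

definition H1_combination :: "'a surface \<Rightarrow> nat \<Rightarrow> (nat \<Rightarrow> 'a chain set) \<Rightarrow> (nat \<Rightarrow> 'a chain set) \<Rightarrow>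
    (nat \<Rightarrow> int) \<Rightarrow> (nat \<Rightarrow> int) \<Rightarrow> 'a chain set" where
  "H1_combination S g a b m n =
     finprod (H1 S) (\<lambda>j. (a j [^]\<^bsub>H1 S\<^esub> m j) \<otimes>\<^bsub>H1 S\<^esub> (b j [^]\<^bsub>H1 S\<^esub> n j)) {1..g}"

text \<open>A basis \<open>a 1, \<dots>, a g, b 1, \<dots>, b g\<close> of the free abelian group \<open>H1 S\<close> (which HOL-Algebra
  writes multiplicatively) with canonical intersection numbers.\<close>

definition symplectic_basis ::
    "'a surface \<Rightarrow> nat \<Rightarrow> (nat \<Rightarrow> 'a chain set) \<Rightarrow> (nat \<Rightarrow> 'a chain set) \<Rightarrow> bool" where
  "symplectic_basis S g a b \<longleftrightarrow>
     (\<forall>j\<in>{1..g}. a j \<in> carrier (H1 S) \<and> b j \<in> carrier (H1 S)) \<and>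
     (\<forall>c\<in>carrier (H1 S). \<exists>m n. c = H1_combination S g a b m n) \<and>
     (\<forall>m n. H1_combination S g a b m n = \<one>\<^bsub>H1 S\<^esub> \<longrightarrow> (\<forall>j\<in>{1..g}. m j = 0 \<and> n j = 0)) \<and>
     (\<forall>i\<in>{1..g}. \<forall>j\<in>{1..g}.
        has_intersection_number S (a i) (a j) 0 \<and>
        has_intersection_number S (b i) (b j) 0 \<and>
        has_intersection_number S (a i) (b j) (if i = j then 1 else 0))"

definition swap_index :: "nat \<Rightarrow> nat \<Rightarrow> nat \<Rightarrow> nat" where
  "swap_index g\<sigma> h j = (if j \<in> {1..g\<sigma>} then j + h else if j \<in> {h+1..h+g\<sigma>} then j - h else j)"

definition involution_basis :: "'a surface \<Rightarrow> ('a \<Rightarrow> 'a) \<Rightarrow> nat \<Rightarrow> nat \<Rightarrow> nat \<Rightarrow>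
    (nat \<Rightarrow> 'a chain set) \<Rightarrow> (nat \<Rightarrow> 'a chain set) \<Rightarrow> bool" where
  "involution_basis S \<sigma> g g\<sigma> h a b \<longleftrightarrow> (\<forall>j\<in>{1..g}.
     H1_map S \<sigma> (a j) = inv\<^bsub>H1 S\<^esub> (a (swap_index g\<sigma> h j)) \<and>
     H1_map S \<sigma> (b j) = inv\<^bsub>H1 S\<^esub> (b (swap_index g\<sigma> h j)))"

text \<open>\<open>Ov\<close> is the set of indices of the "ovals" of the basis. Being an oval of the basis is a
  label that is only visible in the action of \<open>\<tau>\<close> on \<open>b j\<close>: for a torus with one real oval, this
  oval is homologous to \<open>a 1\<close> up to sign, yet \<open>\<tau>\<close> maps \<open>b 1\<close> to \<open>- b 1 + a 1\<close>.\<close>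

definition real_basis :: "'a surface \<Rightarrow> ('a \<Rightarrow> 'a) \<Rightarrow> nat \<Rightarrow> nat set \<Rightarrow>
    (nat \<Rightarrow> 'a chain set) \<Rightarrow> (nat \<Rightarrow> 'a chain set) \<Rightarrow> bool" where
  "real_basis S \<tau> g Ov a b \<longleftrightarrow> (\<forall>j\<in>{1..g}.
     H1_map S \<tau> (a j) = a j \<and>
     H1_map S \<tau> (b j) = (if j \<in> Ov then inv\<^bsub>H1 S\<^esub> (b j) else inv\<^bsub>H1 S\<^esub> (b j) \<otimes>\<^bsub>H1 S\<^esub> a j))"

section \<open>Prym differentials and the Prym matrix\<close>

definition normalized_differentials ::
    "'a surface \<Rightarrow> nat \<Rightarrow> (nat \<Rightarrow> 'a chain set) \<Rightarrow> (nat \<Rightarrow> 'a differential) \<Rightarrow> bool" where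
  "normalized_differentials S g a w \<longleftrightarrow> (\<forall>i\<in>{1..g}. w i \<in> holomorphic_differentials S \<and>
     (\<forall>j\<in>{1..g}. period S (a j) (w i) = (if i = j then 2 * of_real pi * \<i> else 0)))"

definition prym_differential ::
    "(nat \<Rightarrow> 'a differential) \<Rightarrow> nat \<Rightarrow> nat \<Rightarrow> nat \<Rightarrow> 'a differential" where
  "prym_differential w g\<sigma> h i = (if i \<le> g\<sigma> then w i + w (i + h) else w i)"

text \<open>Rows and columns are numbered from 1 to \<open>h\<close>.\<close>

definition prym_matrix :: "'a surface \<Rightarrow> (nat \<Rightarrow> 'a chain set) \<Rightarrow> (nat \<Rightarrow> 'a differential) \<Rightarrow>
    nat \<Rightarrow> nat \<Rightarrow> nat \<Rightarrow> nat \<Rightarrow> complex" where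
  "prym_matrix S b w g\<sigma> h i j =
     (if j \<le> g\<sigma> then period S (b j) (prym_differential w g\<sigma> h i)
      else 1/2 * period S (b j) (prym_differential w g\<sigma> h i))"

definition unit_period_matrix :: "nat \<Rightarrow> nat \<Rightarrow> complex" where
  "unit_period_matrix i j = 2 * of_real pi * \<i> * (if i = j then 1 else 0)"

text \<open>The \<open>q\<close>-th column of an \<open>h \<times> h\<close> matrix.\<close>

definition column :: "nat \<Rightarrow> (nat \<Rightarrow> nat \<Rightarrow> complex) \<Rightarrow> nat \<Rightarrow> nat \<Rightarrow> complex" where
  "column h M q = (\<lambda>i. if i \<in> {1..h} then M i q else 0)"

end

theory Submission
  imports Defs
begin

text \<open>Since \<open>\<tau>\<close> fixes every \<open>a\<^sub>j\<close>, the holomorphic differential \<open>cnj (\<tau>\<^sup>* w\<^sub>i)\<close> has the \<open>a\<close>-periods of \<open>- w\<^sub>i\<close>.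
  A holomorphic differential is determined by its \<open>a\<close>-periods, so \<open>cnj (\<tau>\<^sup>* w\<^sub>i) = - w\<^sub>i\<close>, and comparing the
  integrals of \<open>w\<^sub>i\<close> over \<open>b\<^sub>j\<close> and \<open>\<tau> b\<^sub>j\<close> gives the conjugates of its \<open>b\<close>-periods. Periods are
  homology invariant because a holomorphic differential pulled back to a singular simplex has a
  global primitive, by a Cech gluing argument on a compact convex set.\<close>

section \<open>Gluing local primitives over a compact convex set\<close>

text \<open>A singular simplex is only continuous, so a form cannot be pulled back to it as a form.
  What survives composition with a continuous map is a primitive, regarded as a function on an open
  part of the surface; integrals enter only as differences of its values at end points. The same
  view shapes \<open>conj_pullback\<close>: if \<open>G\<close> is a primitive of \<omega>, then
  \<open>cnj \<circ> G \<circ> \<tau>\<close> is a primitive of the pullback, and the coefficient in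
  a chart is its derivative. The minus sign in
  \<open>cnj (\<tau>\<^sup>* w\<^sub>i) = - w\<^sub>i\<close> comes from the normalization: the
  a-periods are 0 or the purely imaginary \<open>2 * of_real pi * \<i>\<close>. The shift in the
  conjugated b-period is the a-period that enters through the extra \<open>a j\<close> in the action
  of \<tau> on \<open>b j\<close>, hence it occurs only at non-ovals.\<close>

text \<open>The constants by which the local functions differ form a 1-cocycle, and over a convex
  set it can be trivialized by hand. Passing to increments removes the constants; below the Lebesgue
  number of the cover, increments add up around small triangles, so summing them along segments from
  a base point gives a consistent function.\<close>

lemma glue_primitives:
  fixes K :: "'e::real_normed_vector set" and \<G> :: "('e set \<times> ('e \<Rightarrow> 'b::ab_group_add)) set"
  assumes "compact K" "convex K" "K \<noteq> {}"
    and cover: "\<And>x. x \<in> K \<Longrightarrow> \<exists>N G. (N, G) \<in> \<G> \<and> x \<in> N"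
    and opn: "\<And>N G. (N, G) \<in> \<G> \<Longrightarrow> openin (top_of_set K) N"
    and compat: "\<And>N G N' G' x. (N, G) \<in> \<G> \<Longrightarrow> (N', G') \<in> \<G> \<Longrightarrow> x \<in> N \<Longrightarrow> x \<in> N' \<Longrightarrow>
      \<forall>\<^sub>F y in at x within K. G y - G' y = G x - G' x"
  shows "\<exists>F. \<forall>x\<in>K. \<exists>N G. (N, G) \<in> \<G> \<and> x \<in> N \<and> (\<forall>\<^sub>F y in at x within K. F y - F x = G y - G x)"
proof -
  define \<C> where "\<C> = {T. open T \<and> (\<exists>N G. (N, G) \<in> \<G> \<and> K \<inter> T \<subseteq> N)}"
  have "K \<subseteq> \<Union>\<C>"
  proof
    fix x assume "x \<in> K"
    then obtain N G where N: "(N, G) \<in> \<G>" "x \<in> N" using cover by blast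
    then obtain T where "open T" "N = K \<inter> T" using opn by (metis openin_open)
    with N show "x \<in> \<Union>\<C>" unfolding \<C>_def by blast
  qed
  then obtain \<delta> where \<delta>: "\<delta> > 0" "\<And>x. x \<in> K \<Longrightarrow> \<exists>T\<in>\<C>. ball x \<delta> \<subseteq> T"
    using Heine_Borel_lemma[OF \<open>compact K\<close>, of \<C>] unfolding \<C>_def by blast
  \<comment> \<open>\<delta> is a Lebesgue number of the cover: one local function serves the whole
    ball of radius \<delta> around each point.\<close>
  have "\<forall>x\<in>K. \<exists>N G. (N, G) \<in> \<G> \<and> K \<inter> ball x \<delta> \<subseteq> N"
    using \<delta>(2) unfolding \<C>_def by blast
  then obtain Nf Gf where NG: "\<And>x. x \<in> K \<Longrightarrow> (Nf x, Gf x) \<in> \<G> \<and> K \<inter> ball x \<delta> \<subseteq> Nf x"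
    by metis
  define I where "I x y = Gf x y - Gf x x" for x y
  have I_self: "I x x = 0" for x by (simp add: I_def)
  have I_diff: "I y z = I x z - I x y"
    if "x \<in> K" "y \<in> K" "z \<in> K" "dist x y < \<delta>" "dist x z < \<delta>" "dist y z < \<delta>" for x y z
  proof -
    define C where "C = K \<inter> ball x \<delta> \<inter> ball y \<delta>"
    \<comment> \<open>An intersection of balls with the convex set \<open>K\<close> is convex, so
      the locally constant difference of the two chosen functions is constant on it. For a general
      cover the overlaps need not be connected.\<close>
    have "connected C"
      unfolding C_def by (intro convex_connected convex_Int convex_ball \<open>convex K\<close>)
    moreover have "y \<in> C" "z \<in> C" using that \<delta>(1) by (auto simp: C_def)
    moreover have "\<forall>u\<in>C. \<forall>\<^sub>F v in at u within C. Gf y u - Gf x u = Gf y v - Gf x v"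
    proof
      fix u assume u: "u \<in> C"
      then have "u \<in> Nf y" "u \<in> Nf x"
        using NG[OF \<open>x \<in> K\<close>] NG[OF \<open>y \<in> K\<close>] by (auto simp: C_def)
      then have "\<forall>\<^sub>F v in at u within K. Gf y v - Gf x v = Gf y u - Gf x u"
        using compat NG that by blast
      then have "\<forall>\<^sub>F v in at u within C. Gf y v - Gf x v = Gf y u - Gf x u"
        using at_le[of C K u] filter_leD unfolding C_def by blast
      then show "\<forall>\<^sub>F v in at u within C. Gf y u - Gf x u = Gf y v - Gf x v"
        by (simp only: eq_commute)
    qed
    ultimately have "Gf y y - Gf x y = Gf y z - Gf x z"
      by (rule connected_local_const)
    then show ?thesis by (simp add: I_def algebra_simps)
  qed
  obtain x0 where x0: "x0 \<in> K" using \<open>K \<noteq> {}\<close> by blast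
  obtain B where B: "\<And>x. x \<in> K \<Longrightarrow> dist x0 x \<le> B"
    using compact_imp_bounded[OF \<open>compact K\<close>] by (meson bounded_any_center)
  have "B \<ge> 0" using B[OF x0] by simp
  \<comment> \<open>With \<open>m\<close> steps each step along a segment is shorter than
    \<delta>/2. The other half of \<delta> is left for the distance between \<open>x\<close> and
    \<open>y\<close>, so that the diagonals used below stay shorter than \<delta>.\<close>
  obtain m :: nat where m: "2 * B / \<delta> < real m" using reals_Archimedean2 by blast
  then have m0: "m > 0" using \<open>B \<ge> 0\<close> \<delta>(1) by (intro Nat.gr0I) (auto simp: not_less field_simps)
  have Bm: "B / m < \<delta> / 2" using m m0 \<delta>(1) by (simp add: field_simps)
  define p where "p k x = x0 + (real k / real m) *\<^sub>R (x - x0)" for k x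
  have pK: "p k x \<in> K" if "k \<le> m" "x \<in> K" for k x
  proof -
    have "p k x = (1 - real k / real m) *\<^sub>R x0 + (real k / real m) *\<^sub>R x"
      by (simp add: p_def algebra_simps)
    also have "\<dots> \<in> K" using \<open>convex K\<close> x0 that m0
      by (intro convexD_alt) (auto simp: divide_simps)
    finally show ?thesis .
  qed
  have p_step: "dist (p k x) (p (Suc k) x) < \<delta> / 2" if "x \<in> K" for k x
  proof -
    have "p k x - p (Suc k) x = (1 / real m) *\<^sub>R (x0 - x)"
      by (simp add: p_def algebra_simps add_divide_distrib)
    then have "dist (p k x) (p (Suc k) x) = dist x0 x / m"
      by (simp add: dist_norm)
    also have "\<dots> \<le> B / m" using B[OF that] by (simp add: divide_right_mono)
    also have "\<dots> < \<delta> / 2" by (rule Bm)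
    finally show ?thesis .
  qed
  have p_move: "dist (p k x) (p k y) \<le> dist x y" if "k \<le> m" for k x y
  proof -
    have "p k x - p k y = (real k / real m) *\<^sub>R (x - y)"
      by (simp add: p_def algebra_simps)
    then have "dist (p k x) (p k y) = (real k / real m) * dist x y"
      by (simp add: dist_norm)
    also have "\<dots> \<le> 1 * dist x y" using that m0 by (intro mult_right_mono) auto
    finally show ?thesis by simp
  qed
  define F where "F x = (\<Sum>k<m. I (p k x) (p (Suc k) x))" for x
  \<comment> \<open>Both sums run along segments from the base point; the quadrilaterals between them telescope.\<close>
  have F_diff: "F y - F x = I x y" if "x \<in> K" "y \<in> K" "dist x y < \<delta> / 2" for x y
  proof -
    have "I (p k y) (p (Suc k) y) - I (p k x) (p (Suc k) x)
        = I (p (Suc k) x) (p (Suc k) y) - I (p k x) (p k y)" if "k < m" for k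
    proof -
      have d: "dist (p k x) (p k y) < \<delta> / 2" "dist (p (Suc k) x) (p (Suc k) y) < \<delta> / 2"
        using p_move[of k x y] p_move[of "Suc k" x y] \<open>dist x y < \<delta> / 2\<close> that by auto
      note s = p_step[OF \<open>x \<in> K\<close>, of k] p_step[OF \<open>y \<in> K\<close>, of k]
      have d': "dist (p k x) (p (Suc k) y) < \<delta>"
        using dist_triangle[of "p k x" "p (Suc k) y" "p k y"] d s by simp
      \<comment> \<open>The diagonal from \<open>p k x\<close> to \<open>p (Suc k) y\<close> cuts
        the quadrilateral into two triangles, and \<open>I_diff\<close> applies to both with
        \<open>p k x\<close> as the first vertex.\<close>
      have "I (p k y) (p (Suc k) y) = I (p k x) (p (Suc k) y) - I (p k x) (p k y)"
        using d s d' \<delta>(1) pK that \<open>x \<in> K\<close> \<open>y \<in> K\<close> by (intro I_diff) auto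
      moreover have "I (p (Suc k) x) (p (Suc k) y) = I (p k x) (p (Suc k) y) - I (p k x) (p (Suc k) x)"
        using d s d' \<delta>(1) pK that \<open>x \<in> K\<close> \<open>y \<in> K\<close> by (intro I_diff) auto
      ultimately show ?thesis by simp
    qed
    then have "F y - F x = (\<Sum>k<m. I (p (Suc k) x) (p (Suc k) y) - I (p k x) (p k y))"
      by (simp add: F_def sum_subtractf[symmetric])
    also have "\<dots> = I (p m x) (p m y) - I (p 0 x) (p 0 y)"
      by (rule sum_lessThan_telescope)
    also have "\<dots> = I x y" using m0 by (simp add: p_def I_self)
    finally show ?thesis .
  qed
  show ?thesis
  proof (intro exI[of _ F] ballI)
    fix x assume x: "x \<in> K"
    have "\<forall>\<^sub>F y in at x within K. F y - F x = Gf x y - Gf x x"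
      unfolding eventually_at
      by (rule exI[of _ "\<delta> / 2"]) (use F_diff[OF x] \<delta>(1) in \<open>auto simp: I_def dist_commute\<close>)
    then show "\<exists>N G. (N, G) \<in> \<G> \<and> x \<in> N \<and> (\<forall>\<^sub>F y in at x within K. F y - F x = G y - G x)"
      using NG[OF x] x \<delta>(1) by (intro exI[of _ "Nf x"] exI[of _ "Gf x"]) auto
  qed
qed

section \<open>Local primitives of holomorphic differentials\<close>

context
  fixes S :: "'a surface"
  assumes S: "riemann_surface S"
begin

section \<open>Charts as local coordinates\<close>

lemma chart_complex: "(U, \<phi>) \<in> atlas S \<Longrightarrow> complex_chart (stop S) (U, \<phi>)"
  using S by (auto simp: riemann_surface_def)

lemma chart_openin: "(U, \<phi>) \<in> atlas S \<Longrightarrow> openin (stop S) U"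
  using chart_complex by (auto simp: complex_chart_def)

lemma chart_homeo:
  "(U, \<phi>) \<in> atlas S \<Longrightarrow> homeomorphic_map (subtopology (stop S) U) (top_of_set (\<phi> ` U)) \<phi>"
  using chart_complex by (auto simp: complex_chart_def)

lemma chart_ex:
  assumes "p \<in> points S"
  shows "\<exists>U \<phi>. (U, \<phi>) \<in> atlas S \<and> p \<in> U"
proof -
  have "p \<in> (\<Union>(U, \<phi>)\<in>atlas S. U)" using S assms by (simp add: riemann_surface_def)
  then show ?thesis by blast
qed

lemma chart_inj:
  assumes "(U, \<phi>) \<in> atlas S"
  shows "inj_on \<phi> U"
proof -
  have "topspace (subtopology (stop S) U) = U"
    using openin_subset[OF chart_openin[OF assms]] by auto
  then show ?thesis
    using homeomorphic_imp_injective_map[OF chart_homeo[OF assms]] by simp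
qed

lemma chart_inv: "(U, \<phi>) \<in> atlas S \<Longrightarrow> q \<in> U \<Longrightarrow> inv_into U \<phi> (\<phi> q) = q"
  using chart_inj by simp

lemma open_chart_image:
  assumes "(U, \<phi>) \<in> atlas S" "openin (stop S) N"
  shows "open (\<phi> ` (U \<inter> N))"
proof -
  have "openin (subtopology (stop S) U) (U \<inter> N)"
    using assms(2) by (auto simp: openin_subtopology)
  then have "openin (top_of_set (\<phi> ` U)) (\<phi> ` (U \<inter> N))"
    using homeomorphic_imp_open_map[OF chart_homeo[OF assms(1)]] by (simp add: open_map_def)
  moreover have "open (\<phi> ` U)"
    using chart_complex[OF assms(1)] by (auto simp: complex_chart_def)
  ultimately show ?thesis by (simp add: openin_open_eq)
qed

lemma openin_chart_preimage:
  assumes "(U, \<phi>) \<in> atlas S" "open W"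
  shows "openin (stop S) {q\<in>U. \<phi> q \<in> W}"
proof -
  have U: "topspace (subtopology (stop S) U) = U"
    using openin_subset[OF chart_openin[OF assms(1)]] by auto
  have "continuous_map (subtopology (stop S) U) euclidean \<phi>"
    using homeomorphic_imp_continuous_map[OF chart_homeo[OF assms(1)]]
    by (rule continuous_map_into_fulltopology)
  then have "openin (subtopology (stop S) U) {q\<in>U. \<phi> q \<in> W}"
    using openin_continuous_map_preimage[of "subtopology (stop S) U" euclidean \<phi> W] assms(2)
    unfolding U by simp
  then show ?thesis using chart_openin[OF assms(1)] openin_trans_full by blast
qed

lemma transition_holomorphic:
  "(U, \<phi>) \<in> atlas S \<Longrightarrow> (V, \<psi>) \<in> atlas S \<Longrightarrow> (\<psi> \<circ> inv_into U \<phi>) holomorphic_on \<phi> ` (U \<inter> V)"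
  using S unfolding riemann_surface_def by blast

lemma transition_derivative:
  assumes "(U, \<phi>) \<in> atlas S" "(V, \<psi>) \<in> atlas S" "q \<in> U \<inter> V"
  shows "((\<psi> \<circ> inv_into U \<phi>) has_field_derivative deriv (\<psi> \<circ> inv_into U \<phi>) (\<phi> q)) (at (\<phi> q))"
  using assms transition_holomorphic open_chart_image[OF assms(1) chart_openin[OF assms(2)]]
  by (intro holomorphic_derivI) auto

text \<open>\<open>G\<close> is a primitive of \<open>\<omega>\<close> on \<open>N\<close> in every chart at once, so that comparing and pulling back
  primitives needs no coordinate changes.\<close>

definition local_primitive :: "'a differential \<Rightarrow> 'a set \<Rightarrow> ('a \<Rightarrow> complex) \<Rightarrow> bool" where
  "local_primitive \<omega> N G \<longleftrightarrow> openin (stop S) N \<and> (\<forall>(U, \<phi>)\<in>atlas S. \<forall>q\<in>U \<inter> N.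
     ((G \<circ> inv_into U \<phi>) has_field_derivative \<omega> (U, \<phi>) (\<phi> q)) (at (\<phi> q)))"

lemma local_primitive_openin: "local_primitive \<omega> N G \<Longrightarrow> openin (stop S) N"
  by (simp add: local_primitive_def)

lemma local_primitiveD:
  "local_primitive \<omega> N G \<Longrightarrow> (U, \<phi>) \<in> atlas S \<Longrightarrow> q \<in> U \<Longrightarrow> q \<in> N \<Longrightarrow>
    ((G \<circ> inv_into U \<phi>) has_field_derivative \<omega> (U, \<phi>) (\<phi> q)) (at (\<phi> q))"
  by (auto simp: local_primitive_def)

lemma local_primitive_add_const:
  "local_primitive \<omega> N G \<Longrightarrow> local_primitive \<omega> N (\<lambda>q. G q + k)"
  unfolding local_primitive_def
  by (auto simp: comp_def intro!: derivative_eq_intros)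

lemma local_primitive_add:
  "local_primitive \<omega> N G \<Longrightarrow> local_primitive \<omega>' N' G' \<Longrightarrow>
    local_primitive (\<omega> + \<omega>') (N \<inter> N') (\<lambda>q. G q + G' q)"
  unfolding local_primitive_def
  by (auto simp: comp_def intro!: derivative_eq_intros)

lemma local_primitive_scale:
  "local_primitive \<omega> N G \<Longrightarrow> local_primitive (scale_differential k \<omega>) N (\<lambda>q. k * G q)"
  unfolding local_primitive_def scale_differential_def
  by (auto simp: comp_def intro!: derivative_eq_intros)

text \<open>In a coordinate disc around \<open>p\<close> both functions have the same derivative, so
  their difference is constant there. The neighbourhood is shrunk to a disc because the overlap of
  the two domains may be disconnected.\<close>

lemma local_primitive_diff:
  assumes "local_primitive \<omega> N G" "local_primitive \<omega> N' G'" "p \<in> N" "p \<in> N'"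
  shows "\<exists>V. openin (stop S) V \<and> p \<in> V \<and> (\<forall>q\<in>V. G q - G' q = G p - G' p)"
proof -
  have op: "openin (stop S) (N \<inter> N')" using assms local_primitive_openin by blast
  then obtain U \<phi> where U: "(U, \<phi>) \<in> atlas S" "p \<in> U"
    using assms chart_ex openin_subset by (metis IntI subsetD)
  define W where "W = \<phi> ` (U \<inter> (N \<inter> N'))"
  have "open W" unfolding W_def using open_chart_image U op by blast
  moreover have "\<phi> p \<in> W" using assms U by (auto simp: W_def)
  ultimately obtain r where r: "r > 0" "ball (\<phi> p) r \<subseteq> W" by (meson openE)
  define D where "D z = G (inv_into U \<phi> z) - G' (inv_into U \<phi> z)" for z
  have "(D has_field_derivative 0) (at z within ball (\<phi> p) r)" if "z \<in> ball (\<phi> p) r" for z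
  proof -
    from that r obtain q where q: "q \<in> U" "q \<in> N" "q \<in> N'" "z = \<phi> q" by (auto simp: W_def)
    have "((\<lambda>z. (G \<circ> inv_into U \<phi>) z - (G' \<circ> inv_into U \<phi>) z) has_field_derivative
        \<omega> (U, \<phi>) z - \<omega> (U, \<phi>) z) (at z)"
      unfolding q(4)
      using local_primitiveD[OF assms(1) U(1) q(1,2)] local_primitiveD[OF assms(2) U(1) q(1,3)]
      by (rule DERIV_diff)
    then show ?thesis by (simp add: D_def[abs_def] comp_def has_field_derivative_at_within)
  qed
  then obtain c where c: "\<And>z. z \<in> ball (\<phi> p) r \<Longrightarrow> D z = c"
    using has_field_derivative_zero_constant[of "ball (\<phi> p) r" D] by auto
  have Dq: "G q - G' q = c" if "q \<in> U" "\<phi> q \<in> ball (\<phi> p) r" for q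
    using c[OF that(2)] that U by (simp add: D_def chart_inv)
  show ?thesis
    by (rule exI[of _ "{q\<in>U. \<phi> q \<in> ball (\<phi> p) r}"])
      (use Dq U r openin_chart_preimage[OF U(1) open_ball] in auto)
qed

lemma holomorphic_differential_outside_atlas:
  "\<omega> \<in> holomorphic_differentials S \<Longrightarrow> c \<notin> atlas S \<Longrightarrow> \<omega> c = (\<lambda>z. 0)"
  unfolding holomorphic_differentials_def by blast

lemma holomorphic_differential_outside_chart:
  "\<omega> \<in> holomorphic_differentials S \<Longrightarrow> (U, \<phi>) \<in> atlas S \<Longrightarrow> z \<notin> \<phi> ` U \<Longrightarrow> \<omega> (U, \<phi>) z = 0"
  unfolding holomorphic_differentials_def by blast

lemma holomorphic_differential_transition:
  "\<omega> \<in> holomorphic_differentials S \<Longrightarrow> (U, \<phi>) \<in> atlas S \<Longrightarrow> (V, \<psi>) \<in> atlas S \<Longrightarrow> p \<in> U \<inter> V \<Longrightarrow>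
    \<omega> (U, \<phi>) (\<phi> p) = \<omega> (V, \<psi>) (\<psi> p) * deriv (\<psi> \<circ> inv_into U \<phi>) (\<phi> p)"
  unfolding holomorphic_differentials_def by blast

text \<open>The transformation rule for the coefficients of a differential is exactly the chain
  rule, so an antiderivative in one chart is a primitive in every chart.\<close>

lemma local_primitive_chart:
  assumes \<omega>: "\<omega> \<in> holomorphic_differentials S" and U: "(U, \<phi>) \<in> atlas S"
    and W: "open W" "\<And>z. z \<in> W \<Longrightarrow> (P has_field_derivative \<omega> (U, \<phi>) z) (at z)"
  shows "local_primitive \<omega> {q\<in>U. \<phi> q \<in> W} (P \<circ> \<phi>)"
  unfolding local_primitive_def
proof (safe)
  show "openin (stop S) {q \<in> U. \<phi> q \<in> W}" using U W openin_chart_preimage by blast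
next
  fix V \<psi> q assume V: "(V, \<psi>) \<in> atlas S" and q: "q \<in> V" "q \<in> U" "\<phi> q \<in> W"
  have "(P has_field_derivative \<omega> (U, \<phi>) (\<phi> q)) (at ((\<phi> \<circ> inv_into V \<psi>) (\<psi> q)))"
    using W(2)[OF q(3)] q V by (simp add: chart_inv)
  moreover have "((\<phi> \<circ> inv_into V \<psi>) has_field_derivative deriv (\<phi> \<circ> inv_into V \<psi>) (\<psi> q)) (at (\<psi> q))"
    using transition_derivative V U q by blast
  ultimately have "(P \<circ> (\<phi> \<circ> inv_into V \<psi>) has_field_derivative
      \<omega> (U, \<phi>) (\<phi> q) * deriv (\<phi> \<circ> inv_into V \<psi>) (\<psi> q)) (at (\<psi> q))"
    by (rule DERIV_chain)
  also have "\<omega> (U, \<phi>) (\<phi> q) * deriv (\<phi> \<circ> inv_into V \<psi>) (\<psi> q) = \<omega> (V, \<psi>) (\<psi> q)"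
    using holomorphic_differential_transition[OF \<omega> V U] q by simp
  finally show "(P \<circ> \<phi> \<circ> inv_into V \<psi> has_field_derivative \<omega> (V, \<psi>) (\<psi> q)) (at (\<psi> q))"
    by (simp only: comp_assoc)
qed

lemma local_primitive_ex:
  assumes \<omega>: "\<omega> \<in> holomorphic_differentials S" and p: "p \<in> points S"
  shows "\<exists>N G. local_primitive \<omega> N G \<and> p \<in> N"
proof -
  obtain U \<phi> where U: "(U, \<phi>) \<in> atlas S" "p \<in> U" using chart_ex p by blast
  then have "open (\<phi> ` U)" using open_chart_image[OF U(1) chart_openin[OF U(1)]] by simp
  then obtain r where r: "r > 0" "ball (\<phi> p) r \<subseteq> \<phi> ` U" using U by (meson openE imageI)
  have "\<omega> (U, \<phi>) holomorphic_on \<phi> ` U"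
    using \<omega> U unfolding holomorphic_differentials_def by blast
  then have "\<omega> (U, \<phi>) holomorphic_on ball (\<phi> p) r"
    using r(2) by (rule holomorphic_on_subset)
  then obtain P where "\<And>z. z \<in> ball (\<phi> p) r \<Longrightarrow>
      (P has_field_derivative \<omega> (U, \<phi>) z) (at z within ball (\<phi> p) r)"
    using holomorphic_convex_primitive'[OF convex_ball open_ball] by blast
  then have "local_primitive \<omega> {q\<in>U. \<phi> q \<in> ball (\<phi> p) r} (P \<circ> \<phi>)"
    by (intro local_primitive_chart[OF \<omega> U(1) open_ball]) (simp add: at_within_open[OF _ open_ball])
  moreover have "p \<in> {q\<in>U. \<phi> q \<in> ball (\<phi> p) r}" using U r by simp
  ultimately show ?thesis by blast
qed

text \<open>Coefficients that are derivatives of holomorphic functions are themselves holomorphic,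
  and comparing the derivative of one primitive in two charts gives the transformation rule. Sums,
  multiples and conjugate pullbacks are then recognized as differentials by exhibiting
  primitives.\<close>

lemma holomorphic_differentialsI:
  assumes "\<And>c. c \<notin> atlas S \<Longrightarrow> \<omega> c = (\<lambda>z. 0)"
    and "\<And>U \<phi> z. (U, \<phi>) \<in> atlas S \<Longrightarrow> z \<notin> \<phi> ` U \<Longrightarrow> \<omega> (U, \<phi>) z = 0"
    and prim: "\<And>p. p \<in> points S \<Longrightarrow> \<exists>N G. local_primitive \<omega> N G \<and> p \<in> N"
  shows "\<omega> \<in> holomorphic_differentials S"
proof -
  have hol: "\<omega> (U, \<phi>) holomorphic_on \<phi> ` U" if U: "(U, \<phi>) \<in> atlas S" for U \<phi>
  proof -
    have "\<exists>g'. (\<omega> (U, \<phi>) has_field_derivative g') (at z)" if "z \<in> \<phi> ` U" for z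
    proof -
      obtain q where q: "q \<in> U" "z = \<phi> q" using \<open>z \<in> \<phi> ` U\<close> by blast
      then obtain N G where N: "local_primitive \<omega> N G" "q \<in> N"
        using prim openin_subset[OF chart_openin[OF U]] by blast
      define W where "W = \<phi> ` (U \<inter> N)"
      have W: "open W" "z \<in> W"
        using open_chart_image[OF U local_primitive_openin[OF N(1)]] q N by (auto simp: W_def)
      have d: "((G \<circ> inv_into U \<phi>) has_field_derivative \<omega> (U, \<phi>) y) (at y)" if "y \<in> W" for y
        using that local_primitiveD[OF N(1) U] by (auto simp: W_def)
      then have "(G \<circ> inv_into U \<phi>) holomorphic_on W"
        using W(1) by (auto simp: holomorphic_on_open)
      then have "deriv (G \<circ> inv_into U \<phi>) holomorphic_on W"
        using W(1) by (rule holomorphic_deriv)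
      then have "\<omega> (U, \<phi>) holomorphic_on W"
        by (rule holomorphic_transform) (use d DERIV_imp_deriv in auto)
      then show ?thesis using W by (auto simp: holomorphic_on_open)
    qed
    then show ?thesis
      using open_chart_image[OF U chart_openin[OF U]] by (simp add: holomorphic_on_open)
  qed
  have comp: "\<omega> (U, \<phi>) (\<phi> p) = \<omega> (V, \<psi>) (\<psi> p) * deriv (\<psi> \<circ> inv_into U \<phi>) (\<phi> p)"
    if U: "(U, \<phi>) \<in> atlas S" and V: "(V, \<psi>) \<in> atlas S" and p: "p \<in> U" "p \<in> V" for U \<phi> V \<psi> p
  proof -
    obtain N G where N: "local_primitive \<omega> N G" "p \<in> N"
      using prim openin_subset[OF chart_openin[OF U]] p by blast
    define W where "W = \<phi> ` (U \<inter> (V \<inter> N))"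
    have W: "open W" "\<phi> p \<in> W"
      using open_chart_image[OF U, of "V \<inter> N"] local_primitive_openin[OF N(1)] chart_openin[OF V] p N
      by (auto simp: W_def)
    have "((G \<circ> inv_into V \<psi>) has_field_derivative \<omega> (V, \<psi>) (\<psi> p)) (at ((\<psi> \<circ> inv_into U \<phi>) (\<phi> p)))"
      using local_primitiveD[OF N(1) V] p N U by (simp add: chart_inv)
    then have "((G \<circ> inv_into V \<psi>) \<circ> (\<psi> \<circ> inv_into U \<phi>) has_field_derivative
        \<omega> (V, \<psi>) (\<psi> p) * deriv (\<psi> \<circ> inv_into U \<phi>) (\<phi> p)) (at (\<phi> p))"
      using transition_derivative[OF U V] p by (intro DERIV_chain) auto
    \<comment> \<open>The two composites agree only on the image of the overlap of the charts, a
      neighbourhood of \<open>\<phi> p\<close>, which is enough for the derivative.\<close>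
    then have "((G \<circ> inv_into U \<phi>) has_field_derivative
        \<omega> (V, \<psi>) (\<psi> p) * deriv (\<psi> \<circ> inv_into U \<phi>) (\<phi> p)) (at (\<phi> p))"
      by (rule DERIV_cong_ev[THEN iffD1, rotated 3])
        (use W U V in \<open>auto simp: eventually_nhds W_def chart_inv intro!: exI[of _ W]\<close>)
    with local_primitiveD[OF N(1) U p(1) N(2)]
    show ?thesis
      by (rule DERIV_unique)
  qed
  show ?thesis
    unfolding holomorphic_differentials_def mem_Collect_eq
    using assms(1,2) hol comp by blast
qed

section \<open>Primitives along continuous maps\<close>

text \<open>The domain is left general so that the interval (paths) and the triangle (2-simplices)
  are covered at once. \<open>F\<close> lives on \<open>K\<close> and only locally factors through
  \<open>f\<close>: where the image returns to the same point, the values of \<open>F\<close> may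
  differ, and this difference is what periods measure.\<close>

definition primitive_over ::
    "'a differential \<Rightarrow> 'k::metric_space set \<Rightarrow> ('k \<Rightarrow> 'a) \<Rightarrow> ('k \<Rightarrow> complex) \<Rightarrow> bool" where
  "primitive_over \<omega> K f F \<longleftrightarrow> (\<forall>x\<in>K. \<exists>N G e. local_primitive \<omega> N G \<and> e > 0 \<and>
     (\<forall>y\<in>K. dist x y < e \<longrightarrow> f y \<in> N \<and> F y = G (f y)))"

lemma primitive_overE:
  assumes "primitive_over \<omega> K f F" "x \<in> K"
  obtains N G e where "local_primitive \<omega> N G" "e > 0"
    "\<forall>y\<in>K. dist x y < e \<longrightarrow> f y \<in> N \<and> F y = G (f y)"
proof -
  have "\<exists>N G e. local_primitive \<omega> N G \<and> e > 0 \<and> (\<forall>y\<in>K. dist x y < e \<longrightarrow> f y \<in> N \<and> F y = G (f y))"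
    using assms unfolding primitive_over_def by (rule bspec)
  then show ?thesis by (elim exE conjE) (rule that)
qed

lemma primitive_overI:
  assumes "\<And>x. x \<in> K \<Longrightarrow> \<exists>N G e. local_primitive \<omega> N G \<and> e > 0 \<and>
     (\<forall>y\<in>K. dist x y < e \<longrightarrow> f y \<in> N \<and> F y = G (f y))"
  shows "primitive_over \<omega> K f F"
  unfolding primitive_over_def by (rule ballI) (rule assms)

lemma continuous_map_ball_preimage:
  fixes K :: "'k::metric_space set"
  assumes "continuous_map (top_of_set K) X f" "openin X V" "x \<in> K" "f x \<in> V"
  shows "\<exists>e>0. \<forall>y\<in>K. dist x y < e \<longrightarrow> f y \<in> V"
proof -
  have "openin (top_of_set K) {y\<in>K. f y \<in> V}"
    using openin_continuous_map_preimage[OF assms(1,2)] by simp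
  then obtain T where T: "open T" "{y\<in>K. f y \<in> V} = K \<inter> T" by (auto simp: openin_open)
  then have "x \<in> T" using assms by blast
  then obtain e where "e > 0" "ball x e \<subseteq> T" using T by (meson openE)
  then show ?thesis using T by (intro exI[of _ e]) auto
qed

text \<open>Restricts a primitive over a triangle to the edges of the triangle.\<close>

lemma primitive_over_compose:
  fixes K :: "'k::metric_space set" and L :: "'l::metric_space set"
  assumes "primitive_over \<omega> K f F" "continuous_on L h" "h ` L \<subseteq> K"
  shows "primitive_over \<omega> L (f \<circ> h) (F \<circ> h)"
proof (rule primitive_overI)
  fix x assume x: "x \<in> L"
  then have hx: "h x \<in> K" using assms by blast
  obtain N G e where N: "local_primitive \<omega> N G" "e > 0"
    "\<forall>y\<in>K. dist (h x) y < e \<longrightarrow> f y \<in> N \<and> F y = G (f y)"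
    by (rule primitive_overE[OF assms(1) hx])
  obtain d where d: "d > 0" "\<And>y. y \<in> L \<Longrightarrow> dist y x < d \<Longrightarrow> dist (h y) (h x) < e"
    using assms(2) x N(2) unfolding continuous_on_iff by meson
  have "(f \<circ> h) y \<in> N \<and> (F \<circ> h) y = G ((f \<circ> h) y)" if "y \<in> L" "dist x y < d" for y
    using N(3) d(2)[of y] that assms(3) by (auto simp: dist_commute)
  then show "\<exists>N G d. local_primitive \<omega> N G \<and> d > 0 \<and>
     (\<forall>y\<in>L. dist x y < d \<longrightarrow> (f \<circ> h) y \<in> N \<and> (F \<circ> h) y = G ((f \<circ> h) y))"
    using N(1) d(1) by blast
qed

lemma primitive_over_cong:
  assumes "primitive_over \<omega> K f F" "\<And>x. x \<in> K \<Longrightarrow> f x = f' x" "\<And>x. x \<in> K \<Longrightarrow> F x = F' x"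
  shows "primitive_over \<omega> K f' F'"
  using assms unfolding primitive_over_def by simp

lemma primitive_over_add:
  fixes K :: "'k::metric_space set"
  assumes "primitive_over \<omega> K f F" "primitive_over \<omega>' K f F'"
  shows "primitive_over (\<omega> + \<omega>') K f (\<lambda>x. F x + F' x)"
proof (rule primitive_overI)
  fix x assume x: "x \<in> K"
  obtain N G e where N: "local_primitive \<omega> N G" "e > 0"
    "\<forall>y\<in>K. dist x y < e \<longrightarrow> f y \<in> N \<and> F y = G (f y)"
    by (rule primitive_overE[OF assms(1) x])
  obtain N' G' e' where N': "local_primitive \<omega>' N' G'" "e' > 0"
    "\<forall>y\<in>K. dist x y < e' \<longrightarrow> f y \<in> N' \<and> F' y = G' (f y)"
    by (rule primitive_overE[OF assms(2) x])
  show "\<exists>M H d. local_primitive (\<omega> + \<omega>') M H \<and> d > 0 \<and>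
     (\<forall>y\<in>K. dist x y < d \<longrightarrow> f y \<in> M \<and> F y + F' y = H (f y))"
    by (rule exI[of _ "N \<inter> N'"], rule exI[of _ "\<lambda>q. G q + G' q"], rule exI[of _ "min e e'"])
      (use N N' local_primitive_add in auto)
qed

lemma primitive_over_scale:
  assumes "primitive_over \<omega> K f F"
  shows "primitive_over (scale_differential k \<omega>) K f (\<lambda>x. k * F x)"
proof (rule primitive_overI)
  fix x assume x: "x \<in> K"
  obtain N G e where N: "local_primitive \<omega> N G" "e > 0"
    "\<forall>y\<in>K. dist x y < e \<longrightarrow> f y \<in> N \<and> F y = G (f y)"
    by (rule primitive_overE[OF assms x])
  show "\<exists>M H d. local_primitive (scale_differential k \<omega>) M H \<and> d > 0 \<and>
     (\<forall>y\<in>K. dist x y < d \<longrightarrow> f y \<in> M \<and> k * F y = H (f y))"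
    by (rule exI[of _ N], rule exI[of _ "\<lambda>q. k * G q"], rule exI[of _ e])
      (use N local_primitive_scale in auto)
qed

text \<open>Near each parameter both functions factor through primitives of the same differential,
  which differ by a constant near the image point. Thus the difference is locally constant on a
  connected set.\<close>

lemma primitive_over_unique:
  fixes K :: "'k::metric_space set"
  assumes F: "primitive_over \<omega> K f F" "primitive_over \<omega> K f F'"
    and f: "continuous_map (top_of_set K) (stop S) f" and K: "connected K" "x \<in> K" "y \<in> K"
  shows "F x - F' x = F y - F' y"
proof (rule connected_local_const[OF K, of "\<lambda>z. F z - F' z"], intro ballI)
  fix u assume u: "u \<in> K"
  obtain N G e where N: "local_primitive \<omega> N G" "e > 0"
    "\<forall>y\<in>K. dist u y < e \<longrightarrow> f y \<in> N \<and> F y = G (f y)"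
    by (rule primitive_overE[OF F(1) u])
  obtain N' G' e' where N': "local_primitive \<omega> N' G'" "e' > 0"
    "\<forall>y\<in>K. dist u y < e' \<longrightarrow> f y \<in> N' \<and> F' y = G' (f y)"
    by (rule primitive_overE[OF F(2) u])
  have "f u \<in> N" "f u \<in> N'" using N(2,3) N'(2,3) u by auto
  obtain V where V: "openin (stop S) V" "f u \<in> V" "\<And>q. q \<in> V \<Longrightarrow> G q - G' q = G (f u) - G' (f u)"
    using local_primitive_diff[OF N(1) N'(1) \<open>f u \<in> N\<close> \<open>f u \<in> N'\<close>] by blast
  then obtain d where d: "d > 0" "\<And>y. y \<in> K \<Longrightarrow> dist u y < d \<Longrightarrow> f y \<in> V"
    using continuous_map_ball_preimage[OF f V(1) u V(2)] by blast
  have "F u - F' u = F v - F' v" if "v \<in> K" "dist v u < min d (min e e')" for v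
    using V(3)[OF d(2)[OF that(1)]] that N(3) N'(3) u N(2) N'(2) by (simp add: dist_commute)
  then show "\<forall>\<^sub>F v in at u within K. F u - F' u = F v - F' v"
    unfolding eventually_at using d(1) N(2) N'(2)
    by (intro exI[of _ "min d (min e e')"]) auto
qed

text \<open>The family to be glued consists of the local primitives composed with \<open>f\<close>;
  their compatibility is \<open>local_primitive_diff\<close> transported by continuity of
  \<open>f\<close>.\<close>

lemma primitive_over_ex:
  fixes K :: "'e::real_normed_vector set"
  assumes \<omega>: "\<omega> \<in> holomorphic_differentials S" and K: "compact K" "convex K" "K \<noteq> {}"
    and f: "continuous_map (top_of_set K) (stop S) f"
  shows "\<exists>F. primitive_over \<omega> K f F"
proof -
  define \<G> where "\<G> = {({x\<in>K. f x \<in> N}, G \<circ> f) | N G. local_primitive \<omega> N G}"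
  have "\<exists>F. \<forall>x\<in>K. \<exists>N G. (N, G) \<in> \<G> \<and> x \<in> N \<and> (\<forall>\<^sub>F y in at x within K. F y - F x = G y - G x)"
  proof (rule glue_primitives[OF K])
    fix x assume "x \<in> K"
    then have "f x \<in> points S" using f by (auto simp: continuous_map_def)
    then obtain N G where "local_primitive \<omega> N G" "f x \<in> N"
      using local_primitive_ex[OF \<omega>] by blast
    with \<open>x \<in> K\<close> show "\<exists>N G. (N, G) \<in> \<G> \<and> x \<in> N"
      unfolding \<G>_def by (intro exI[of _ "{x\<in>K. f x \<in> N}"] exI[of _ "G \<circ> f"]) auto
  next
    fix N G assume "(N, G) \<in> \<G>"
    then show "openin (top_of_set K) N"
      using openin_continuous_map_preimage[OF f] local_primitive_openin by (auto simp: \<G>_def)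
  next
    fix M H M' H' x
    assume "(M, H) \<in> \<G>" "(M', H') \<in> \<G>" and x: "x \<in> M" "x \<in> M'"
    then obtain N G N' G' where N: "local_primitive \<omega> N G" "M = {x\<in>K. f x \<in> N}" "H = G \<circ> f"
      and N': "local_primitive \<omega> N' G'" "M' = {x\<in>K. f x \<in> N'}" "H' = G' \<circ> f"
      by (auto simp: \<G>_def)
    have fx: "f x \<in> N" "f x \<in> N'" using x unfolding N(2) N'(2) by simp_all
    obtain V where V: "openin (stop S) V" "f x \<in> V" "\<And>q. q \<in> V \<Longrightarrow> G q - G' q = G (f x) - G' (f x)"
      using local_primitive_diff[OF N(1) N'(1) fx] by blast
    have "x \<in> K" using x N by simp
    then obtain d where "d > 0" "\<And>y. y \<in> K \<Longrightarrow> dist x y < d \<Longrightarrow> f y \<in> V"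
      using continuous_map_ball_preimage[OF f V(1) _ V(2)] by blast
    then show "\<forall>\<^sub>F y in at x within K. H y - H' y = H x - H' x"
      unfolding eventually_at N(3) N'(3) using V(3) by (intro exI[of _ d]) (auto simp: dist_commute)
  qed
  then obtain F where F: "\<And>x. x \<in> K \<Longrightarrow> \<exists>N G. (N, G) \<in> \<G> \<and> x \<in> N \<and>
      (\<forall>\<^sub>F y in at x within K. F y - F x = G y - G x)" by blast
  have "primitive_over \<omega> K f F"
  proof (rule primitive_overI)
    fix x assume x: "x \<in> K"
    obtain N G where N: "local_primitive \<omega> N G" "f x \<in> N"
      and ev: "\<forall>\<^sub>F y in at x within K. F y - F x = G (f y) - G (f x)"
      using F[OF x] by (auto simp: \<G>_def)
    obtain d where d: "d > 0" "\<And>y. y \<in> K \<Longrightarrow> y \<noteq> x \<Longrightarrow> dist y x < d \<Longrightarrow> F y - F x = G (f y) - G (f x)"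
      using ev unfolding eventually_at by auto
    obtain e where e: "e > 0" "\<And>y. y \<in> K \<Longrightarrow> dist x y < e \<Longrightarrow> f y \<in> N"
      using continuous_map_ball_preimage[OF f local_primitive_openin[OF N(1)] x N(2)] by blast
    \<comment> \<open>Gluing prescribes only increments, so the local primitive is shifted to take
      the value of \<open>F\<close> at \<open>x\<close>. At \<open>y = x\<close> itself, about which
      the punctured filter says nothing, equality holds by this choice of constant.\<close>
    define H where "H q = G q + (F x - G (f x))" for q
    have "local_primitive \<omega> N H" unfolding H_def using N(1) by (rule local_primitive_add_const)
    moreover have "F y = H (f y)" if "y \<in> K" "dist x y < min d e" for y
      using d(2)[OF that(1)] that(2) by (cases "y = x") (auto simp: H_def dist_commute algebra_simps)
    ultimately show "\<exists>N H e. local_primitive \<omega> N H \<and> e > 0 \<and>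
        (\<forall>y\<in>K. dist x y < e \<longrightarrow> f y \<in> N \<and> F y = H (f y))"
      using d(1) e by (intro exI[of _ N] exI[of _ H] exI[of _ "min d e"]) auto
  qed
  then show ?thesis by blast
qed

text \<open>Connects the integral, which is defined through charts, with the chart-free primitives
  for which existence and uniqueness are available.\<close>

lemma primitive_along_iff:
  assumes \<omega>: "\<omega> \<in> holomorphic_differentials S"
    and \<gamma>: "continuous_map (top_of_set {0..1}) (stop S) \<gamma>"
  shows "primitive_along S \<omega> \<gamma> F \<longleftrightarrow> primitive_over \<omega> {0..1} \<gamma> F"
proof
  assume F: "primitive_along S \<omega> \<gamma> F"
  show "primitive_over \<omega> {0..1} \<gamma> F"
  proof (rule primitive_overI)
    fix t :: real assume "t \<in> {0..1}"
    with F have "\<exists>(U, \<phi>)\<in>atlas S. \<exists>W P e.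
       \<gamma> t \<in> U \<and> open W \<and> W \<subseteq> \<phi> ` U \<and> (\<forall>z\<in>W. (P has_field_derivative \<omega> (U, \<phi>) z) (at z)) \<and>
       e > 0 \<and> (\<forall>s\<in>{0..1}. \<bar>s - t\<bar> < e \<longrightarrow> \<gamma> s \<in> U \<and> \<phi> (\<gamma> s) \<in> W \<and> F s = P (\<phi> (\<gamma> s)))"
      unfolding primitive_along_def by (rule bspec)
    then obtain U \<phi> W P e where U: "(U, \<phi>) \<in> atlas S" and W: "open W"
      and P: "\<forall>z\<in>W. (P has_field_derivative \<omega> (U, \<phi>) z) (at z)" and e: "e > 0"
      and *: "\<forall>s\<in>{0..1}. \<bar>s - t\<bar> < e \<longrightarrow> \<gamma> s \<in> U \<and> \<phi> (\<gamma> s) \<in> W \<and> F s = P (\<phi> (\<gamma> s))"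
      by (elim bexE case_prodE exE conjE) simp
    have "local_primitive \<omega> {q\<in>U. \<phi> q \<in> W} (P \<circ> \<phi>)"
      using local_primitive_chart[OF \<omega> U W bspec[OF P]] .
    then show "\<exists>N G e. local_primitive \<omega> N G \<and> e > 0 \<and>
        (\<forall>s\<in>{0..1}. dist t s < e \<longrightarrow> \<gamma> s \<in> N \<and> F s = G (\<gamma> s))"
      using e * by (intro exI[of _ "{q\<in>U. \<phi> q \<in> W}"] exI[of _ "P \<circ> \<phi>"] exI[of _ e])
        (auto simp: dist_real_def abs_minus_commute)
  qed
next
  assume F: "primitive_over \<omega> {0..1} \<gamma> F"
  show "primitive_along S \<omega> \<gamma> F"
    unfolding primitive_along_def
  proof
    fix t :: real assume t: "t \<in> {0..1}"
    obtain N G e where N: "local_primitive \<omega> N G" "e > 0"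
    "\<forall>s\<in>{0..1}. dist t s < e \<longrightarrow> \<gamma> s \<in> N \<and> F s = G (\<gamma> s)"
    by (rule primitive_overE[OF F t])
    have "\<gamma> t \<in> points S" using \<gamma> t by (auto simp: continuous_map_def)
    then obtain U \<phi> where U: "(U, \<phi>) \<in> atlas S" "\<gamma> t \<in> U" using chart_ex by blast
    obtain d where d: "d > 0" "\<And>s. s \<in> {0..1} \<Longrightarrow> dist t s < d \<Longrightarrow> \<gamma> s \<in> U"
      using continuous_map_ball_preimage[OF \<gamma> chart_openin[OF U(1)] t U(2)] by blast
    define W where "W = \<phi> ` (U \<inter> N)"
    define P where "P = G \<circ> inv_into U \<phi>"
    have "open W" unfolding W_def by (rule open_chart_image[OF U(1) local_primitive_openin[OF N(1)]])
    moreover have "W \<subseteq> \<phi> ` U" by (auto simp: W_def)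
    moreover have "\<forall>z\<in>W. (P has_field_derivative \<omega> (U, \<phi>) z) (at z)"
      using local_primitiveD[OF N(1) U(1)] by (auto simp: W_def P_def)
    moreover have "\<gamma> s \<in> U \<and> \<phi> (\<gamma> s) \<in> W \<and> F s = P (\<phi> (\<gamma> s))"
      if "s \<in> {0..1}" "\<bar>s - t\<bar> < min d e" for s
    proof -
      have "dist t s < d" "dist t s < e" using that(2) by (auto simp: dist_real_def)
      with that(1) d(2) N(3) show ?thesis by (simp add: W_def P_def chart_inv[OF U(1)])
    qed
    ultimately show "\<exists>(U, \<phi>)\<in>atlas S. \<exists>W P e. \<gamma> t \<in> U \<and> open W \<and> W \<subseteq> \<phi> ` U \<and>
        (\<forall>z\<in>W. (P has_field_derivative \<omega> (U, \<phi>) z) (at z)) \<and> e > 0 \<and>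
        (\<forall>s\<in>{0..1}. \<bar>s - t\<bar> < e \<longrightarrow> \<gamma> s \<in> U \<and> \<phi> (\<gamma> s) \<in> W \<and> F s = P (\<phi> (\<gamma> s)))"
      using U d(1) N(2)
      by (intro bexI[OF _ U(1)] case_prodI exI[of _ W] exI[of _ P] exI[of _ "min d e"]) auto
  qed
qed

lemma path_integral_eqI:
  assumes \<omega>: "\<omega> \<in> holomorphic_differentials S"
    and \<gamma>: "continuous_map (top_of_set {0..1}) (stop S) \<gamma>" and F: "primitive_over \<omega> {0..1} \<gamma> F"
  shows "path_integral S \<omega> \<gamma> = F 1 - F 0"
  unfolding path_integral_def
proof (rule the_equality)
  show "\<exists>F'. primitive_along S \<omega> \<gamma> F' \<and> F 1 - F 0 = F' 1 - F' 0"
    using F primitive_along_iff[OF \<omega> \<gamma>] by blast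
next
  fix I assume "\<exists>F'. primitive_along S \<omega> \<gamma> F' \<and> I = F' 1 - F' 0"
  then obtain F' where F': "primitive_over \<omega> {0..1} \<gamma> F'" "I = F' 1 - F' 0"
    using primitive_along_iff[OF \<omega> \<gamma>] by blast
  have "F 1 - F' 1 = F 0 - F' 0"
    by (rule primitive_over_unique[OF F F'(1) \<gamma>]) auto
  then have "F 1 = F 0 - F' 0 + F' 1" by (simp only: diff_eq_eq)
  with F'(2) show "I = F 1 - F 0" by simp
qed

lemma path_primitive_ex:
  assumes "\<omega> \<in> holomorphic_differentials S"
    and "continuous_map (top_of_set {0..1}) (stop S) \<gamma>"
  shows "\<exists>F. primitive_over \<omega> {0..1::real} \<gamma> F"
  using assms by (intro primitive_over_ex) auto

section \<open>Linearity of path integrals in the differential\<close>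

lemma holomorphic_differentials_add:
  assumes "\<omega> \<in> holomorphic_differentials S" "\<omega>' \<in> holomorphic_differentials S"
  shows "\<omega> + \<omega>' \<in> holomorphic_differentials S"
proof (rule holomorphic_differentialsI)
  fix p assume "p \<in> points S"
  then show "\<exists>N G. local_primitive (\<omega> + \<omega>') N G \<and> p \<in> N"
    using local_primitive_ex assms local_primitive_add by (metis IntI)
qed (use assms in \<open>auto simp: plus_fun_def
    holomorphic_differential_outside_atlas holomorphic_differential_outside_chart\<close>)

lemma holomorphic_differentials_scale:
  assumes "\<omega> \<in> holomorphic_differentials S"
  shows "scale_differential k \<omega> \<in> holomorphic_differentials S"
proof (rule holomorphic_differentialsI)
  fix p assume "p \<in> points S"
  then show "\<exists>N G. local_primitive (scale_differential k \<omega>) N G \<and> p \<in> N"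
    using local_primitive_ex assms local_primitive_scale by metis
qed (use assms in \<open>auto simp: scale_differential_def
    holomorphic_differential_outside_atlas holomorphic_differential_outside_chart\<close>)

lemma path_integral_add:
  assumes "\<omega> \<in> holomorphic_differentials S" "\<omega>' \<in> holomorphic_differentials S"
    and \<gamma>: "continuous_map (top_of_set {0..1}) (stop S) \<gamma>"
  shows "path_integral S (\<omega> + \<omega>') \<gamma> = path_integral S \<omega> \<gamma> + path_integral S \<omega>' \<gamma>"
proof -
  obtain F F' where "primitive_over \<omega> {0..1::real} \<gamma> F" "primitive_over \<omega>' {0..1::real} \<gamma> F'"
    using path_primitive_ex assms by metis
  with assms show ?thesis
    using path_integral_eqI[OF holomorphic_differentials_add[OF assms(1,2)] \<gamma> primitive_over_add]
    by (simp add: path_integral_eqI)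
qed

lemma path_integral_scale:
  assumes "\<omega> \<in> holomorphic_differentials S"
    and \<gamma>: "continuous_map (top_of_set {0..1}) (stop S) \<gamma>"
  shows "path_integral S (scale_differential k \<omega>) \<gamma> = k * path_integral S \<omega> \<gamma>"
proof -
  obtain F where "primitive_over \<omega> {0..1::real} \<gamma> F"
    using path_primitive_ex assms by metis
  with assms show ?thesis
    using path_integral_eqI[OF holomorphic_differentials_scale[OF assms(1)] \<gamma> primitive_over_scale]
    by (simp add: path_integral_eqI algebra_simps)
qed

section \<open>Periods\<close>

lemma edge_path_continuous:
  "continuous_map (top_of_set {0..1})
     (subtopology (powertop_real UNIV) (standard_simplex (Suc 0))) edge_path"
proof -
  have "continuous_map (top_of_set {0..1}) euclideanreal (\<lambda>t. edge_path t k)" for k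
    by (cases "k = 0"; cases "k = 1") (auto simp: edge_path_def intro!: continuous_intros)
  then have "continuous_map (top_of_set {0..1}) (powertop_real UNIV) edge_path"
    by (simp add: continuous_map_componentwise_UNIV)
  moreover have "edge_path t \<in> standard_simplex (Suc 0)" if "t \<in> {0..1}" for t
    using that by (auto simp: standard_simplex_def edge_path_def)
  ultimately show ?thesis by (auto simp: continuous_map_in_subtopology)
qed

lemma singular_simplex_edge_path:
  assumes "singular_simplex (Suc 0) X f"
  shows "continuous_map (top_of_set {0..1}) X (f \<circ> edge_path)"
  by (rule continuous_map_compose[OF edge_path_continuous]) (use assms in \<open>simp add: singular_simplex_def\<close>)

text \<open>Faces and images of singular simplices are restricted to the standard simplex, so paths
  built from them agree with the expected composites only for parameters in the unit
  interval.\<close>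

lemma path_integral_cong:
  assumes "\<And>t. t \<in> {0..1} \<Longrightarrow> \<gamma> t = \<gamma>' t"
  shows "path_integral S \<omega> \<gamma> = path_integral S \<omega> \<gamma>'"
proof -
  have "primitive_along S \<omega> \<gamma> = primitive_along S \<omega> \<gamma>'"
    unfolding primitive_along_def fun_eq_iff using assms by simp
  then show ?thesis by (simp add: path_integral_def)
qed

section \<open>Integration over singular chains\<close>

text \<open>Cancellation can make the keys of a sum fewer than those of its summands; over a common
  finite superset additivity becomes termwise.\<close>

lemma chain_integral_superset:
  assumes "finite A" "Poly_Mapping.keys c \<subseteq> A"
  shows "chain_integral S \<omega> c =
    (\<Sum>f\<in>A. of_int (poly_mapping.lookup c f) * path_integral S \<omega> (f \<circ> edge_path))"
  unfolding chain_integral_def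
  by (rule sum.mono_neutral_left) (use assms in \<open>auto simp: in_keys_iff\<close>)

lemma chain_integral_add: "chain_integral S \<omega> (c + d) = chain_integral S \<omega> c + chain_integral S \<omega> d"
proof -
  define A where "A = Poly_Mapping.keys c \<union> Poly_Mapping.keys d"
  have "finite A" "Poly_Mapping.keys (c + d) \<subseteq> A" "Poly_Mapping.keys c \<subseteq> A" "Poly_Mapping.keys d \<subseteq> A"
    using keys_add[of c d] by (auto simp: A_def)
  then show ?thesis
    by (simp add: chain_integral_superset[of A] lookup_add sum.distrib distrib_right)
qed

lemma chain_integral_0 [simp]: "chain_integral S \<omega> 0 = 0"
  by (simp add: chain_integral_def)

lemma chain_integral_minus [simp]: "chain_integral S \<omega> (- c) = - chain_integral S \<omega> c"
  using chain_integral_add[of \<omega> "- c" c] by (simp add: eq_neg_iff_add_eq_0)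

lemma chain_integral_diff: "chain_integral S \<omega> (c - d) = chain_integral S \<omega> c - chain_integral S \<omega> d"
  using chain_integral_add[of \<omega> c "- d"] by simp

lemma chain_integral_frag_of [simp]:
  "chain_integral S \<omega> (frag_of f) = path_integral S \<omega> (f \<circ> edge_path)"
  by (simp add: chain_integral_def)

section \<open>Stokes' theorem for singular 2-chains\<close>

text \<open>A planar model of \<open>standard_simplex 2\<close>: gluing takes place in a normed
  space, whereas the points of the standard simplex are functions on the natural numbers.
  \<open>triangle_point\<close> gives the barycentric coordinates.\<close>

definition triangle :: "(real \<times> real) set" where
  "triangle = {z. 0 \<le> fst z \<and> 0 \<le> snd z \<and> fst z + snd z \<le> 1}"

definition triangle_point :: "real \<times> real \<Rightarrow> nat \<Rightarrow> real" where
  "triangle_point z i =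
     (if i = 0 then 1 - fst z - snd z else if i = 1 then fst z else if i = 2 then snd z else 0)"

lemma triangle_convex: "convex triangle"
proof -
  have "triangle = {z. 0 \<le> fst z} \<inter> {z. 0 \<le> snd z} \<inter> {z. inner (1, 1) z \<le> 1}"
    by (auto simp: triangle_def)
  also have "convex \<dots>"
    by (intro convex_Int convex_halfspace_le)
      (auto simp: convex_def)
  finally show ?thesis .
qed

lemma triangle_compact: "compact triangle"
proof (rule compact_Int_closed[of "cbox (0, 0) (1, 1)" triangle, THEN back_subst[of compact]])
  have "triangle = {z. 0 \<le> fst z} \<inter> {z. 0 \<le> snd z} \<inter> {z. fst z + snd z \<le> 1}"
    by (auto simp: triangle_def)
  also have "closed \<dots>"
    by (intro closed_Int closed_Collect_le continuous_intros)
  finally show "closed triangle" .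
  show "cbox (0, 0) (1, 1) \<inter> triangle = triangle"
    by (auto simp: triangle_def cbox_Pair_eq)
qed simp

lemma triangle_point_continuous:
  "continuous_map (top_of_set triangle) (subtopology (powertop_real UNIV) (standard_simplex 2)) triangle_point"
proof -
  have "continuous_map (top_of_set triangle) euclideanreal (\<lambda>z. triangle_point z k)" for k
    by (cases "k = 0"; cases "k = 1"; cases "k = 2")
      (auto simp: triangle_point_def intro!: continuous_intros)
  then have "continuous_map (top_of_set triangle) (powertop_real UNIV) triangle_point"
    by (simp add: continuous_map_componentwise_UNIV)
  moreover have "triangle_point z \<in> standard_simplex 2" if "z \<in> triangle" for z
    using that by (auto simp: standard_simplex_def triangle_point_def triangle_def numeral_2_eq_2)
  ultimately show ?thesis by (auto simp: continuous_map_in_subtopology)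
qed

text \<open>A primitive over the whole triangle turns the integral over each side into a difference
  of its values at two vertices. In the alternating sum of the three sides every vertex value
  cancels.\<close>

lemma stokes_singular_simplex:
  assumes \<omega>: "\<omega> \<in> holomorphic_differentials S" and f: "singular_simplex 2 (stop S) f"
  shows "chain_integral S \<omega> (chain_boundary 2 (frag_of f)) = 0"
proof -
  have "continuous_map (top_of_set triangle) (stop S) (f \<circ> triangle_point)"
    by (rule continuous_map_compose[OF triangle_point_continuous])
      (use f in \<open>simp add: singular_simplex_def\<close>)
  moreover have "(0, 0) \<in> triangle" by (simp add: triangle_def)
  then have "triangle \<noteq> {}" by blast
  ultimately obtain F where F: "primitive_over \<omega> triangle (f \<circ> triangle_point) F"
    using primitive_over_ex[OF \<omega> triangle_compact triangle_convex] by blast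
  have face: "path_integral S \<omega> (singular_face 2 k f \<circ> edge_path) = F (e 1) - F (e 0)"
    if k: "k \<le> 2" and e: "continuous_on {0..1} e" "e ` {0..1} \<subseteq> triangle"
      and eq: "\<And>t. simplical_face k (edge_path t) = triangle_point (e t)" for k e
  proof -
    have "singular_simplex (Suc 0) (stop S) (singular_face 2 k f)"
      using singular_simplex_singular_face[OF f _ k] by simp
    then have c: "continuous_map (top_of_set {0..1}) (stop S) (singular_face 2 k f \<circ> edge_path)"
      by (rule singular_simplex_edge_path)
    have "primitive_over \<omega> {0..1} (singular_face 2 k f \<circ> edge_path) (F \<circ> e)"
    proof (rule primitive_over_cong[OF primitive_over_compose[OF F e]])
      fix t :: real assume "t \<in> {0..1}"
      then have "edge_path t \<in> standard_simplex (Suc 0)"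
        using edge_path_continuous by (auto simp: continuous_map_in_subtopology)
      then show "((f \<circ> triangle_point) \<circ> e) t = (singular_face 2 k f \<circ> edge_path) t"
        by (simp add: singular_face_def eq)
    qed simp
    then show ?thesis using path_integral_eqI[OF \<omega> c] by simp
  qed
  \<comment> \<open>Face \<open>k\<close> inserts a zero at position \<open>k\<close> into the
    barycentric coordinates \<open>(1 - t, t)\<close>; the last two of the resulting three
    coordinates are the planar point.\<close>
  have sf: "simplical_face 0 (edge_path t) = triangle_point (1 - t, t)"
    "simplical_face (Suc 0) (edge_path t) = triangle_point (0, t)"
    "simplical_face 2 (edge_path t) = triangle_point (t, 0)" for t
    by (auto simp: fun_eq_iff simplical_face_def edge_path_def triangle_point_def)
  have "path_integral S \<omega> (singular_face 2 0 f \<circ> edge_path) = F (0, 1) - F (1, 0)"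
    by (subst face[of 0 "\<lambda>t. (1 - t, t)", OF _ _ _ sf(1)])
      (auto simp: triangle_def intro!: continuous_intros)
  moreover have "path_integral S \<omega> (singular_face 2 (Suc 0) f \<circ> edge_path) = F (0, 1) - F (0, 0)"
    by (subst face[of "Suc 0" "\<lambda>t. (0, t)", OF _ _ _ sf(2)])
      (auto simp: triangle_def intro!: continuous_intros)
  moreover have "path_integral S \<omega> (singular_face 2 2 f \<circ> edge_path) = F (1, 0) - F (0, 0)"
    by (subst face[of 2 "\<lambda>t. (t, 0)", OF _ _ _ sf(3)])
      (auto simp: triangle_def intro!: continuous_intros)
  ultimately show ?thesis
    by (simp add: chain_boundary_of numeral_2_eq_2 chain_integral_add chain_integral_diff)
qed

lemma stokes:
  assumes \<omega>: "\<omega> \<in> holomorphic_differentials S" and "singular_chain 2 (stop S) c"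
  shows "chain_integral S \<omega> (chain_boundary 2 c) = 0"
  using assms(2) unfolding singular_chain_def
  by (induction rule: frag_induction)
    (auto simp: stokes_singular_simplex[OF \<omega>] chain_boundary_diff chain_integral_diff)

section \<open>Periods as functions of the homology class and of the differential\<close>

lemma H1_representative:
  assumes "C \<in> carrier (H1 S)"
  obtains c where "c \<in> C" "singular_relcycle (Suc 0) (stop S) {} c"
    "C = homologous_rel_set (Suc 0) (stop S) {} c"
proof -
  obtain c where c: "singular_relcycle (Suc 0) (stop S) {} c"
    "C = homologous_rel_set (Suc 0) (stop S) {} c"
    using assms carrier_relative_homology_group[of "Suc 0" "stop S" "{}"] by auto
  then show ?thesis by (intro that[of c]) auto
qed

text \<open>Two cycles in one class differ by the boundary of a 2-chain, whose integral vanishes by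
  \<open>stokes\<close>; hence the definite description in \<open>period\<close> denotes.\<close>

lemma period_eq:
  assumes \<omega>: "\<omega> \<in> holomorphic_differentials S" and C: "C \<in> carrier (H1 S)" and "c \<in> C"
  shows "period S C \<omega> = chain_integral S \<omega> c"
proof -
  have "\<forall>d\<in>C. chain_integral S \<omega> d = chain_integral S \<omega> c"
  proof
    fix d assume "d \<in> C"
    then have "homologous_rel (Suc 0) (stop S) {} c d"
      using C \<open>c \<in> C\<close>
      by (elim H1_representative) (auto intro: homologous_rel_trans simp: homologous_rel_sym)
    then obtain e where "singular_chain 2 (stop S) e" "chain_boundary 2 e = c - d"
      by (auto simp: homologous_rel_def singular_boundary numeral_2_eq_2)
    then show "chain_integral S \<omega> d = chain_integral S \<omega> c"
      using stokes[OF \<omega>, of e] by (simp add: chain_integral_diff)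
  qed
  then show ?thesis unfolding period_def using \<open>c \<in> C\<close> by (intro the_equality) (assumption, metis)
qed

lemma group_H1: "group (H1 S)"
  by simp

lemma period_mult:
  assumes \<omega>: "\<omega> \<in> holomorphic_differentials S" and C: "C \<in> carrier (H1 S)" and D: "D \<in> carrier (H1 S)"
  shows "period S (C \<otimes>\<^bsub>H1 S\<^esub> D) \<omega> = period S C \<omega> + period S D \<omega>"
proof -
  obtain c where c: "c \<in> C" using C by (rule H1_representative)
  obtain d where d: "d \<in> D" using D by (rule H1_representative)
  have "c + d \<in> C \<otimes>\<^bsub>H1 S\<^esub> D"
    using mult_relative_homology_group[of "Suc 0" "stop S" "{}"] c d by auto
  moreover have "C \<otimes>\<^bsub>H1 S\<^esub> D \<in> carrier (H1 S)"
    using C D by (intro monoid.m_closed group.is_monoid group_H1)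
  ultimately show ?thesis
    using period_eq[OF \<omega>] C D c d by (simp add: chain_integral_add)
qed

lemma period_inv:
  assumes \<omega>: "\<omega> \<in> holomorphic_differentials S" and C: "C \<in> carrier (H1 S)"
  shows "period S (inv\<^bsub>H1 S\<^esub> C) \<omega> = - period S C \<omega>"
proof -
  obtain c where c: "c \<in> C" using C by (rule H1_representative)
  then have "- c \<in> inv\<^bsub>H1 S\<^esub> C"
    using inv_relative_homology_group[of C "Suc 0" "stop S" "{}"] C by simp
  moreover have "inv\<^bsub>H1 S\<^esub> C \<in> carrier (H1 S)"
    using C by (intro group.inv_closed group_H1)
  ultimately show ?thesis using period_eq[OF \<omega>] C c by simp
qed

lemma chain_integral_differential_add:
  assumes "\<omega> \<in> holomorphic_differentials S" "\<omega>' \<in> holomorphic_differentials S"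
    and "singular_chain (Suc 0) (stop S) c"
  shows "chain_integral S (\<omega> + \<omega>') c = chain_integral S \<omega> c + chain_integral S \<omega>' c"
  using assms(3) unfolding singular_chain_def
proof (induction rule: frag_induction)
  case (one f)
  then show ?case
    by (simp only: chain_integral_frag_of mem_Collect_eq path_integral_add[OF assms(1,2)]
        singular_simplex_edge_path)
qed (auto simp: chain_integral_diff)

lemma chain_integral_differential_scale:
  assumes "\<omega> \<in> holomorphic_differentials S" and "singular_chain (Suc 0) (stop S) c"
  shows "chain_integral S (scale_differential k \<omega>) c = k * chain_integral S \<omega> c"
  using assms(2) unfolding singular_chain_def
  by (induction rule: frag_induction)
    (auto simp: path_integral_scale[OF assms(1)] singular_simplex_edge_path chain_integral_diff algebra_simps)

lemma period_add:
  assumes "\<omega> \<in> holomorphic_differentials S" "\<omega>' \<in> holomorphic_differentials S" "C \<in> carrier (H1 S)"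
  shows "period S C (\<omega> + \<omega>') = period S C \<omega> + period S C \<omega>'"
proof -
  obtain c where "c \<in> C" "singular_relcycle (Suc 0) (stop S) {} c"
    using assms(3) by (rule H1_representative)
  then show ?thesis
    using assms period_eq holomorphic_differentials_add chain_integral_differential_add
    by (simp add: singular_relcycle)
qed

lemma period_scale:
  assumes "\<omega> \<in> holomorphic_differentials S" "C \<in> carrier (H1 S)"
  shows "period S C (scale_differential k \<omega>) = k * period S C \<omega>"
proof -
  obtain c where "c \<in> C" "singular_relcycle (Suc 0) (stop S) {} c"
    using assms(2) by (rule H1_representative)
  then show ?thesis
    using assms period_eq holomorphic_differentials_scale chain_integral_differential_scale
    by (simp add: singular_relcycle)
qed

section \<open>Pullback along an antiholomorphic map\<close>

text \<open>The derivative does not depend on the local primitive selected by \<open>SOME\<close>.\<close>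

definition conj_pullback :: "('a \<Rightarrow> 'a) \<Rightarrow> 'a differential \<Rightarrow> 'a differential" where
  "conj_pullback \<tau> \<omega> = (\<lambda>(U, \<phi>) z. if (U, \<phi>) \<in> atlas S \<and> z \<in> \<phi> ` U
     then deriv (cnj \<circ> (SOME G. \<exists>N. local_primitive \<omega> N G \<and> \<tau> (inv_into U \<phi> z) \<in> N) \<circ> \<tau> \<circ> inv_into U \<phi>) z
     else 0)"

text \<open>Two conjugations are inserted between \<psi> and its inverse. Then
  \<open>cnj \<circ> \<psi> \<circ> \<tau>\<close> is holomorphic in the coordinate \<phi> because
  \<tau> is antiholomorphic, and \<open>G\<close> read in the coordinate \<psi> stays complex
  differentiable when both its argument and its value are conjugated.\<close>

lemma conj_pullback_differentiable:
  assumes \<tau>: "antiholomorphic_map S S \<tau>" and G: "local_primitive \<omega> N G"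
    and U: "(U, \<phi>) \<in> atlas S" and q: "q \<in> U" "\<tau> q \<in> N"
  shows "(cnj \<circ> G \<circ> \<tau> \<circ> inv_into U \<phi>) field_differentiable at (\<phi> q)"
proof -
  have cont: "continuous_map (stop S) (stop S) \<tau>"
    using \<tau> by (simp add: antiholomorphic_map_def)
  have "\<tau> q \<in> points S" using openin_subset[OF local_primitive_openin[OF G]] q by blast
  then obtain V \<psi> where V: "(V, \<psi>) \<in> atlas S" "\<tau> q \<in> V" using chart_ex by blast
  define u where "u = cnj \<circ> \<psi> \<circ> \<tau> \<circ> inv_into U \<phi>"
  define A where "A = {p\<in>points S. \<tau> p \<in> V}"
  have A: "openin (stop S) A"
    unfolding A_def by (rule openin_continuous_map_preimage[OF cont chart_openin[OF V(1)]])
  have UA: "{p\<in>U. \<tau> p \<in> V} = U \<inter> A"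
    using openin_subset[OF chart_openin[OF U]] by (auto simp: A_def)
  have "u holomorphic_on \<phi> ` {p\<in>U. \<tau> p \<in> V}"
    using \<tau> U V(1) unfolding antiholomorphic_map_def u_def by blast
  then have "u holomorphic_on \<phi> ` (U \<inter> A)" unfolding UA .
  moreover have opn: "open (\<phi> ` (U \<inter> A))" by (rule open_chart_image[OF U A])
  moreover have \<phi>q: "\<phi> q \<in> \<phi> ` (U \<inter> A)" using q V(2) UA by blast
  ultimately have u: "(u has_field_derivative deriv u (\<phi> q)) (at (\<phi> q))"
    by (rule holomorphic_derivI)
  have cu: "cnj (u (\<phi> q)) = \<psi> (\<tau> q)" using q U by (simp add: u_def chart_inv)
  have "((G \<circ> inv_into V \<psi>) has_field_derivative \<omega> (V, \<psi>) (\<psi> (\<tau> q))) (at (cnj (u (\<phi> q))))"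
    unfolding cu by (rule local_primitiveD[OF G V q(2)])
  then have "((cnj \<circ> (G \<circ> inv_into V \<psi>) \<circ> cnj) has_field_derivative cnj (\<omega> (V, \<psi>) (\<psi> (\<tau> q))))
      (at (u (\<phi> q)))"
    using has_field_derivative_cnj_cnj by fastforce
  from DERIV_chain[OF this u]
  have "((cnj \<circ> G \<circ> \<tau> \<circ> inv_into U \<phi>) has_field_derivative
      cnj (\<omega> (V, \<psi>) (\<psi> (\<tau> q))) * deriv u (\<phi> q)) (at (\<phi> q))"
  proof (rule has_field_derivative_transform_within_open[OF _ opn \<phi>q])
    fix z assume "z \<in> \<phi> ` (U \<inter> A)"
    then obtain p where "p \<in> U" "\<tau> p \<in> V" "z = \<phi> p" using UA by blast
    then show "(cnj \<circ> (G \<circ> inv_into V \<psi>) \<circ> cnj \<circ> u) z = (cnj \<circ> G \<circ> \<tau> \<circ> inv_into U \<phi>) z"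
      using U V by (simp add: u_def chart_inv)
  qed
  then show ?thesis unfolding field_differentiable_def by blast
qed

text \<open>Near \<open>\<tau> q\<close> the given primitive and the one selected in the definition
  differ by a constant, which does not affect the derivative.\<close>

lemma conj_pullback_local_primitive:
  assumes \<tau>: "antiholomorphic_map S S \<tau>" and G: "local_primitive \<omega> N G"
  shows "local_primitive (conj_pullback \<tau> \<omega>) {p\<in>points S. \<tau> p \<in> N} (cnj \<circ> G \<circ> \<tau>)"
proof -
  have cont: "continuous_map (stop S) (stop S) \<tau>"
    using \<tau> by (simp add: antiholomorphic_map_def)
  have "((cnj \<circ> G \<circ> \<tau> \<circ> inv_into U \<phi>) has_field_derivative conj_pullback \<tau> \<omega> (U, \<phi>) (\<phi> q)) (at (\<phi> q))"
    if U: "(U, \<phi>) \<in> atlas S" and q: "q \<in> U" "\<tau> q \<in> N" for U \<phi> q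
  proof -
    define G' where "G' = (SOME G. \<exists>N. local_primitive \<omega> N G \<and> \<tau> q \<in> N)"
    have "\<exists>N. local_primitive \<omega> N G' \<and> \<tau> q \<in> N"
      unfolding G'_def by (rule someI[of "\<lambda>G. \<exists>N. local_primitive \<omega> N G \<and> \<tau> q \<in> N" G]) (use G q in blast)
    then obtain N' where G': "local_primitive \<omega> N' G'" "\<tau> q \<in> N'" by blast
    obtain V where V: "openin (stop S) V" "\<tau> q \<in> V" "\<And>p. p \<in> V \<Longrightarrow> G p - G' p = G (\<tau> q) - G' (\<tau> q)"
      using local_primitive_diff[OF G G'(1) q(2) G'(2)] by blast
    define k where "k = cnj (G (\<tau> q) - G' (\<tau> q))"
    define A where "A = {p\<in>points S. \<tau> p \<in> V}"
    have A: "openin (stop S) A"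
      unfolding A_def by (rule openin_continuous_map_preimage[OF cont V(1)])
    have opn: "open (\<phi> ` (U \<inter> A))" by (rule open_chart_image[OF U A])
    have \<phi>q: "\<phi> q \<in> \<phi> ` (U \<inter> A)"
      using q V(2) openin_subset[OF chart_openin[OF U]] by (auto simp: A_def)
    have cp: "conj_pullback \<tau> \<omega> (U, \<phi>) (\<phi> q) = deriv (cnj \<circ> G' \<circ> \<tau> \<circ> inv_into U \<phi>) (\<phi> q)"
      using U q by (simp add: conj_pullback_def chart_inv G'_def)
    have "((cnj \<circ> G' \<circ> \<tau> \<circ> inv_into U \<phi>) has_field_derivative conj_pullback \<tau> \<omega> (U, \<phi>) (\<phi> q)) (at (\<phi> q))"
      unfolding cp using conj_pullback_differentiable[OF \<tau> G'(1) U q(1) G'(2)]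
      by (rule field_differentiable_derivI)
    then have "((\<lambda>z. (cnj \<circ> G' \<circ> \<tau> \<circ> inv_into U \<phi>) z + k) has_field_derivative
        conj_pullback \<tau> \<omega> (U, \<phi>) (\<phi> q) + 0) (at (\<phi> q))"
      by (rule DERIV_add[OF _ DERIV_const])
    then have "((\<lambda>z. (cnj \<circ> G' \<circ> \<tau> \<circ> inv_into U \<phi>) z + k) has_field_derivative
        conj_pullback \<tau> \<omega> (U, \<phi>) (\<phi> q)) (at (\<phi> q))"
      by simp
    then show ?thesis
    proof (rule has_field_derivative_transform_within_open[OF _ opn \<phi>q])
      fix z assume "z \<in> \<phi> ` (U \<inter> A)"
      then obtain p where p: "p \<in> U" "\<tau> p \<in> V" "z = \<phi> p" by (auto simp: A_def)
      have "G (\<tau> p) = G' (\<tau> p) + (G (\<tau> q) - G' (\<tau> q))"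
        using V(3)[OF p(2)] by (simp only: diff_eq_eq add.commute)
      then show "(cnj \<circ> G' \<circ> \<tau> \<circ> inv_into U \<phi>) z + k = (cnj \<circ> G \<circ> \<tau> \<circ> inv_into U \<phi>) z"
        using p U by (simp add: k_def chart_inv)
    qed
  qed
  then show ?thesis
    unfolding local_primitive_def
    using openin_continuous_map_preimage[OF cont local_primitive_openin[OF G]] by auto
qed

lemma conj_pullback_holomorphic:
  assumes \<tau>: "antiholomorphic_map S S \<tau>" and \<omega>: "\<omega> \<in> holomorphic_differentials S"
  shows "conj_pullback \<tau> \<omega> \<in> holomorphic_differentials S"
proof (rule holomorphic_differentialsI)
  fix p assume p: "p \<in> points S"
  then have "\<tau> p \<in> points S"
    using \<tau> by (auto simp: antiholomorphic_map_def continuous_map_def)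
  then obtain N G where "local_primitive \<omega> N G" "\<tau> p \<in> N"
    using local_primitive_ex[OF \<omega>] by blast
  then have "local_primitive (conj_pullback \<tau> \<omega>) {p\<in>points S. \<tau> p \<in> N} (cnj \<circ> G \<circ> \<tau>)"
    "p \<in> {p\<in>points S. \<tau> p \<in> N}"
    using conj_pullback_local_primitive[OF \<tau>] p by auto
  then show "\<exists>N G. local_primitive (conj_pullback \<tau> \<omega>) N G \<and> p \<in> N" by blast
qed (auto simp: conj_pullback_def split: prod.splits)

text \<open>Conjugating a primitive of \<omega> along \<open>\<tau> \<circ> \<gamma>\<close> gives a
  primitive of the pullback along \<gamma>, so the end-point differences are conjugate.\<close>

lemma path_integral_conj_pullback:
  assumes \<tau>: "antiholomorphic_map S S \<tau>" and \<omega>: "\<omega> \<in> holomorphic_differentials S"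
    and \<gamma>: "continuous_map (top_of_set {0..1}) (stop S) \<gamma>"
  shows "path_integral S \<omega> (\<tau> \<circ> \<gamma>) = cnj (path_integral S (conj_pullback \<tau> \<omega>) \<gamma>)"
proof -
  have \<tau>\<gamma>: "continuous_map (top_of_set {0..1}) (stop S) (\<tau> \<circ> \<gamma>)"
    using \<tau> by (intro continuous_map_compose[OF \<gamma>]) (simp add: antiholomorphic_map_def)
  obtain F where F: "primitive_over \<omega> {0..1} (\<tau> \<circ> \<gamma>) F"
    using path_primitive_ex[OF \<omega> \<tau>\<gamma>] by blast
  have "primitive_over (conj_pullback \<tau> \<omega>) {0..1} \<gamma> (cnj \<circ> F)"
  proof (rule primitive_overI)
    fix t :: real assume t: "t \<in> {0..1}"
    obtain N G e where N: "local_primitive \<omega> N G" "e > 0"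
      "\<forall>s\<in>{0..1}. dist t s < e \<longrightarrow> (\<tau> \<circ> \<gamma>) s \<in> N \<and> F s = G ((\<tau> \<circ> \<gamma>) s)"
      by (rule primitive_overE[OF F t])
    have "\<gamma> s \<in> points S" if "s \<in> {0..1}" for s
      using \<gamma> that by (auto simp: continuous_map_def)
    then have "\<forall>s\<in>{0..1}. dist t s < e \<longrightarrow>
        \<gamma> s \<in> {p\<in>points S. \<tau> p \<in> N} \<and> (cnj \<circ> F) s = (cnj \<circ> G \<circ> \<tau>) (\<gamma> s)"
      using N(3) by simp
    with conj_pullback_local_primitive[OF \<tau> N(1)] N(2)
    show "\<exists>N G e. local_primitive (conj_pullback \<tau> \<omega>) N G \<and> e > 0 \<and>
        (\<forall>s\<in>{0..1}. dist t s < e \<longrightarrow> \<gamma> s \<in> N \<and> (cnj \<circ> F) s = G (\<gamma> s))"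
      by (intro exI conjI)
  qed
  from path_integral_eqI[OF conj_pullback_holomorphic[OF \<tau> \<omega>] \<gamma> this]
  show ?thesis using path_integral_eqI[OF \<omega> \<tau>\<gamma> F] by simp
qed

lemma chain_integral_conj_pullback:
  assumes \<tau>: "antiholomorphic_map S S \<tau>" and \<omega>: "\<omega> \<in> holomorphic_differentials S"
    and "singular_chain (Suc 0) (stop S) c"
  shows "chain_integral S \<omega> (chain_map (Suc 0) \<tau> c) = cnj (chain_integral S (conj_pullback \<tau> \<omega>) c)"
  using assms(3) unfolding singular_chain_def
proof (induction rule: frag_induction)
  case (one f)
  then have f: "singular_simplex (Suc 0) (stop S) f" by simp
  have "path_integral S \<omega> (simplex_map (Suc 0) \<tau> f \<circ> edge_path) = path_integral S \<omega> (\<tau> \<circ> (f \<circ> edge_path))"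
  proof (rule path_integral_cong)
    fix t :: real assume "t \<in> {0..1}"
    then have "edge_path t \<in> standard_simplex (Suc 0)"
      using edge_path_continuous by (auto simp: continuous_map_in_subtopology)
    then show "(simplex_map (Suc 0) \<tau> f \<circ> edge_path) t = (\<tau> \<circ> (f \<circ> edge_path)) t"
      by (simp add: simplex_map_def)
  qed
  then show ?case
    using path_integral_conj_pullback[OF \<tau> \<omega> singular_simplex_edge_path[OF f]] by simp
qed (auto simp: chain_integral_diff chain_map_diff)

lemma period_conj_pullback:
  assumes \<tau>: "antiholomorphic_map S S \<tau>" and \<omega>: "\<omega> \<in> holomorphic_differentials S"
    and C: "C \<in> carrier (H1 S)"
  shows "period S (H1_map S \<tau> C) \<omega> = cnj (period S C (conj_pullback \<tau> \<omega>))"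
proof -
  obtain c where c: "c \<in> C" "singular_relcycle (Suc 0) (stop S) {} c"
    "C = homologous_rel_set (Suc 0) (stop S) {} c"
    using C by (rule H1_representative)
  have "H1_map S \<tau> C = homologous_rel_set (Suc 0) (stop S) {} (chain_map (Suc 0) \<tau> c)"
    using hom_induced_chain_map[of "stop S" "stop S" \<tau> "{}" "{}" "Suc 0" c] \<tau> c
    by (simp add: antiholomorphic_map_def)
  then have "chain_map (Suc 0) \<tau> c \<in> H1_map S \<tau> C" by simp
  moreover have "H1_map S \<tau> C \<in> carrier (H1 S)" by (rule hom_induced_carrier)
  ultimately have "period S (H1_map S \<tau> C) \<omega> = chain_integral S \<omega> (chain_map (Suc 0) \<tau> c)"
    by (intro period_eq[OF \<omega>])
  also have "\<dots> = cnj (chain_integral S (conj_pullback \<tau> \<omega>) c)"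
    using c(2) by (intro chain_integral_conj_pullback[OF \<tau> \<omega>]) (simp add: singular_relcycle)
  also have "chain_integral S (conj_pullback \<tau> \<omega>) c = period S C (conj_pullback \<tau> \<omega>)"
    by (rule period_eq[OF conj_pullback_holomorphic[OF \<tau> \<omega>] C c(1), symmetric])
  finally show ?thesis .
qed

section \<open>Differentials without a-periods\<close>

lemma holomorphic_differentials_0: "0 \<in> holomorphic_differentials S"
  unfolding holomorphic_differentials_def zero_fun_def by auto

lemma period_zero_differential: "C \<in> carrier (H1 S) \<Longrightarrow> period S C 0 = 0"
  using period_add[OF holomorphic_differentials_0 holomorphic_differentials_0] by simp

interpretation differentials: vector_space scale_differential
  by (rule vector_space_differentials)

lemma holomorphic_differentials_subspace: "differentials.subspace (holomorphic_differentials S)"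
  by (intro differentials.subspaceI holomorphic_differentials_0 holomorphic_differentials_add
      holomorphic_differentials_scale)

lemma period_sum:
  assumes "finite I" "\<And>i. i \<in> I \<Longrightarrow> w i \<in> holomorphic_differentials S" "C \<in> carrier (H1 S)"
  shows "period S C (\<Sum>i\<in>I. scale_differential (c i) (w i)) = (\<Sum>i\<in>I. c i * period S C (w i))"
  using assms(1,2)
proof (induction rule: finite_induct)
  case empty
  then show ?case by (simp only: sum.empty period_zero_differential[OF assms(3)])
next
  case (insert i I)
  have "(\<Sum>i\<in>I. scale_differential (c i) (w i)) \<in> holomorphic_differentials S"
    using insert.prems
    by (intro differentials.subspace_sum[OF holomorphic_differentials_subspace] holomorphic_differentials_scale) auto
  then have "period S C (scale_differential (c i) (w i) + (\<Sum>i\<in>I. scale_differential (c i) (w i)))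
      = c i * period S C (w i) + period S C (\<Sum>i\<in>I. scale_differential (c i) (w i))"
    using insert.prems assms(3)
    by (subst period_add) (auto simp: holomorphic_differentials_scale period_scale)
  then show ?case
    using insert by (simp only: sum.insert insert_iff simp_thms)
qed

text \<open>The genus is by definition the dimension of the space of differentials, so \<open>g\<close> differentials
  with independent \<open>a\<close>-periods span it, and no Riemann bilinear relations are needed.\<close>

lemma vanishing_a_periods:
  assumes g: "genus S = g" and a: "\<And>j. j \<in> {1..g} \<Longrightarrow> a j \<in> carrier (H1 S)"
    and w: "normalized_differentials S g a w"
    and \<eta>: "\<eta> \<in> holomorphic_differentials S" "\<And>j. j \<in> {1..g} \<Longrightarrow> period S (a j) \<eta> = 0"
    and "g \<ge> 1"
  shows "\<eta> = 0"
proof -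
  let ?V = "holomorphic_differentials S"
  have wV: "w i \<in> ?V" if "i \<in> {1..g}" for i
    using w that by (simp add: normalized_differentials_def)
  have wp: "period S (a j) (w i) = (if i = j then 2 * of_real pi * \<i> else 0)"
    if "i \<in> {1..g}" "j \<in> {1..g}" for i j
    using w that by (simp add: normalized_differentials_def)
  \<comment> \<open>By the normalization the a-periods read off the coefficients of a combination of
    the \<open>w i\<close>; this yields both independence and, at the end, the vanishing of
    \<eta>.\<close>
  have coeff: "period S (a j) (\<Sum>i\<in>{1..g}. scale_differential (c i) (w i)) = 2 * of_real pi * \<i> * c j"
    if "j \<in> {1..g}" for c j
  proof -
    have "period S (a j) (\<Sum>i\<in>{1..g}. scale_differential (c i) (w i))
        = (\<Sum>i\<in>{1..g}. c i * period S (a j) (w i))"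
      by (rule period_sum) (use wV a that in auto)
    also have "\<dots> = (\<Sum>i\<in>{1..g}. if j = i then 2 * of_real pi * \<i> * c j else 0)"
      by (rule sum.cong) (use wp that in auto)
    also have "\<dots> = 2 * of_real pi * \<i> * c j"
      using that by simp
    finally show ?thesis .
  qed
  have inj: "inj_on w {1..g}"
  proof (rule inj_onI)
    fix i j assume i: "i \<in> {1..g}" and j: "j \<in> {1..g}" and eq: "w i = w j"
    have "(if j = i then 2 * of_real pi * \<i> else 0) = 2 * of_real pi * \<i>"
      using wp[OF i i] wp[OF j i] unfolding eq by (simp only: refl if_True)
    then show "i = j" by (cases "j = i") auto
  qed
  have span_w: "\<exists>c. v = (\<Sum>i\<in>{1..g}. scale_differential (c i) (w i))"
    if "v \<in> differentials.span (w ` {1..g})" for v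
  proof -
    from that obtain u where "v = (\<Sum>x\<in>w ` {1..g}. scale_differential (u x) x)"
      by (auto simp: differentials.span_finite)
    then have "v = (\<Sum>i\<in>{1..g}. scale_differential (u (w i)) (w i))"
      by (simp only: sum.reindex[OF inj] comp_def)
    then show ?thesis by (rule exI[of _ "\<lambda>i. u (w i)"])
  qed
  have indep: "differentials.independent (w ` {1..g})"
  proof
    assume "differentials.dependent (w ` {1..g})"
    then obtain u x where x: "x \<in> w ` {1..g}" "u x \<noteq> 0"
      and u: "(\<Sum>x\<in>w ` {1..g}. scale_differential (u x) x) = 0"
      unfolding differentials.dependent_finite[OF finite_imageI[OF finite_atLeastAtMost]] by blast
    then obtain j where j: "j \<in> {1..g}" "x = w j" by blast
    have "(\<Sum>i\<in>{1..g}. scale_differential (u (w i)) (w i)) = 0"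
      using u by (simp only: sum.reindex[OF inj] comp_def)
    then have "2 * of_real pi * \<i> * u (w j) = 0"
      using coeff[OF j(1), of "\<lambda>i. u (w i)"] period_zero_differential[OF a[OF j(1)]] by simp
    then show False using x j by simp
  qed
  obtain B where B: "B \<subseteq> ?V" "differentials.independent B" "?V \<subseteq> differentials.span B" "card B = g"
    using differentials.basis_exists g unfolding genus_def by metis
  \<comment> \<open>An infinite set has \<open>card\<close> 0, so a positive cardinality forces
    finiteness.\<close>
  have "finite B" using B(4) \<open>g \<ge> 1\<close> by (intro card_ge_0_finite) simp
  \<comment> \<open>Otherwise \<eta> and the \<open>w i\<close> would be \<open>g + 1\<close>
    independent elements in the span of the \<open>g\<close> elements of \<open>B\<close>.\<close>
  have "\<eta> \<in> differentials.span (w ` {1..g})"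
  proof (rule ccontr)
    assume \<eta>_out: "\<eta> \<notin> differentials.span (w ` {1..g})"
    then have "differentials.independent (insert \<eta> (w ` {1..g}))"
      using indep by (rule differentials.independent_insertI)
    moreover have "insert \<eta> (w ` {1..g}) \<subseteq> differentials.span B"
      using B(3) \<eta>(1) wV by blast
    ultimately have "card (insert \<eta> (w ` {1..g})) \<le> g"
      using differentials.independent_span_bound[OF \<open>finite B\<close>] B(4) by blast
    moreover have "\<eta> \<notin> w ` {1..g}" using \<eta>_out differentials.span_base by blast
    moreover have "card (w ` {1..g}) = g" using card_image[OF inj] by simp
    ultimately show False by simp
  qed
  then obtain c where c: "\<eta> = (\<Sum>i\<in>{1..g}. scale_differential (c i) (w i))"
    using span_w by blast
  have "c j = 0" if "j \<in> {1..g}" for j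
    using coeff[OF that, of c] \<eta>(2)[OF that] c by simp
  then have "\<eta> = (\<Sum>i\<in>{1..g}. 0)"
    unfolding c by (intro sum.cong) (auto simp: scale_differential_def fun_eq_iff)
  then show ?thesis by simp
qed

lemma period_real_basis:
  assumes \<tau>: "antiholomorphic_map S S \<tau>" and g: "genus S = g" and sym: "symplectic_basis S g a b"
    and real: "real_basis S \<tau> g Ov a b" and w: "normalized_differentials S g a w"
    and i: "i \<in> {1..g}" and j: "j \<in> {1..g}"
  shows "cnj (period S (b j) (w i)) =
    period S (b j) (w i) - (if i = j \<and> j \<notin> Ov then 2 * of_real pi * \<i> else 0)"
proof -
  have a: "a k \<in> carrier (H1 S)" and b: "b k \<in> carrier (H1 S)" if "k \<in> {1..g}" for k
    using sym that by (auto simp: symplectic_basis_def)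
  have w_hol: "w i \<in> holomorphic_differentials S"
    and wp: "period S (a k) (w i) = (if i = k then 2 * of_real pi * \<i> else 0)" if "k \<in> {1..g}" for k
    using w i that by (auto simp: normalized_differentials_def)
  note wi = w_hol[OF i]
  have \<tau>wi: "conj_pullback \<tau> (w i) \<in> holomorphic_differentials S"
    by (rule conj_pullback_holomorphic[OF \<tau> wi])
  have "period S (a k) (w i + conj_pullback \<tau> (w i)) = 0" if k: "k \<in> {1..g}" for k
  proof -
    have "H1_map S \<tau> (a k) = a k" using real k by (simp add: real_basis_def)
    then have "period S (a k) (conj_pullback \<tau> (w i)) = cnj (period S (a k) (w i))"
      using period_conj_pullback[OF \<tau> wi a[OF k]] by simp
    then show ?thesis using period_add[OF wi \<tau>wi a[OF k]] wp[OF k] by simp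
  qed
  \<comment> \<open>The sum, not the difference, has vanishing a-periods, because conjugation
    changes the sign of \<open>2 * of_real pi * \<i>\<close>.\<close>
  then have "w i + conj_pullback \<tau> (w i) = 0"
    using i by (intro vanishing_a_periods[OF g a w holomorphic_differentials_add[OF wi \<tau>wi]]) auto
  then have "period S (b j) (w i) + period S (b j) (conj_pullback \<tau> (w i)) = 0"
    using period_add[OF wi \<tau>wi b[OF j]] period_zero_differential[OF b[OF j]] by simp
  then have "cnj (period S (b j) (w i)) = - period S (H1_map S \<tau> (b j)) (w i)"
    unfolding period_conj_pullback[OF \<tau> wi b[OF j]] by (metis add_eq_0_iff2 complex_cnj_minus)
  also have "period S (H1_map S \<tau> (b j)) (w i) =
      - period S (b j) (w i) + (if i = j \<and> j \<notin> Ov then 2 * of_real pi * \<i> else 0)"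
  proof (cases "j \<in> Ov")
    case True
    then have "H1_map S \<tau> (b j) = inv\<^bsub>H1 S\<^esub> (b j)" using real j by (simp add: real_basis_def)
    then show ?thesis using True period_inv[OF wi b[OF j]] by simp
  next
    case False
    then have "H1_map S \<tau> (b j) = inv\<^bsub>H1 S\<^esub> (b j) \<otimes>\<^bsub>H1 S\<^esub> a j"
      using real j by (simp add: real_basis_def)
    moreover have "inv\<^bsub>H1 S\<^esub> (b j) \<in> carrier (H1 S)"
      using b[OF j] by (intro group.inv_closed group_H1)
    ultimately show ?thesis
      using False period_mult[OF wi _ a[OF j]] period_inv[OF wi b[OF j]] wp[OF j] by simp
  qed
  finally show ?thesis by simp
qed

end

section \<open>From normalized differentials to columns of the Prym matrix\<close>

theorem lemma3p3:
  fixes S :: "'a surface"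
    and \<sigma> \<tau> :: "'a \<Rightarrow> 'a"
    and g g\<sigma> n h r0 r1 :: nat
    and Ov :: "nat set"
    and a b :: "nat \<Rightarrow> 'a chain set"
    and w :: "nat \<Rightarrow> 'a differential"
    and P A :: "nat \<Rightarrow> nat \<Rightarrow> complex"
  assumes "real_curve_with_involution S \<sigma> \<tau>"
    and "non_separating S \<tau>"
    and "genus S = g"
    and "genus (quotient_surface S \<sigma>) = g\<sigma>"
    and "divisor_degree (quotient_surface S \<sigma>)
           (branch_divisor S (quotient_surface S \<sigma>) (orbit_map \<sigma>)) = 2 * int n"
    and "n \<ge> 1"
    and "h = g\<sigma> + n - 1"
    and "g = h + g\<sigma>"
    and "symplectic_basis S g a b"
    and "involution_basis S \<sigma> g g\<sigma> h a b"
    and "Ov \<subseteq> {1..g}"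
    and "real_basis S \<tau> g Ov a b"
    and "r0 \<le> g\<sigma>"
    and "r1 \<le> n - 1"
    and "Ov \<inter> {1..h} = {1..r0} \<union> {g\<sigma>+1..g\<sigma>+r1}"
    and "normalized_differentials S g a w"
    and "P = column h (prym_matrix S b w g\<sigma> h)"
    and "A = column h unit_period_matrix"
  shows "(\<forall>\<beta>\<in>{1..r0}. cnj \<circ> P \<beta> = P \<beta>) \<and>
         (\<forall>j\<in>{g\<sigma>+1..g\<sigma>+r1}. cnj \<circ> P j = P j) \<and>
         (\<forall>\<beta>\<in>{r0+1..g\<sigma>}. cnj \<circ> P \<beta> = (\<lambda>i. P \<beta> i - A \<beta> i)) \<and>
         (\<forall>j\<in>{g\<sigma>+r1+1..h}. cnj \<circ> P j = (\<lambda>i. P j i - 1/2 * A j i))"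
proof -
  have S: "riemann_surface S" and \<tau>: "antiholomorphic_map S S \<tau>"
    using assms(1) by (auto simp: real_curve_with_involution_def compact_riemann_surface_def)
  have h: "g\<sigma> \<le> h" using assms(6,7) by simp
  have Ov: "j \<in> Ov \<longleftrightarrow> j \<in> {1..r0} \<or> j \<in> {g\<sigma>+1..g\<sigma>+r1}" if "j \<in> {1..h}" for j
    using assms(15) that by blast
  note conj_w = period_real_basis[OF S \<tau> assms(3,9,12,16)]
  have w: "w i \<in> holomorphic_differentials S" if "i \<in> {1..g}" for i
    using assms(16) that by (simp add: normalized_differentials_def)
  have b: "b j \<in> carrier (H1 S)" if "j \<in> {1..g}" for j
    using assms(9) that by (simp add: symplectic_basis_def)
  have conj_prym: "cnj (period S (b j) (prym_differential w g\<sigma> h i)) =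
      period S (b j) (prym_differential w g\<sigma> h i) - (if j \<in> Ov then 0 else unit_period_matrix i j)"
    if i: "i \<in> {1..h}" and j: "j \<in> {1..h}" for i j
  proof -
    have ij: "i \<in> {1..g}" "j \<in> {1..g}" using i j assms(8) by auto
    show ?thesis
    proof (cases "i \<le> g\<sigma>")
      case True
      \<comment> \<open>The summand \<open>w (i + h)\<close> has its only nonzero a-period on the
        cycle with index \<open>i + h\<close>, which exceeds \<open>h\<close>. For columns up to
        \<open>h\<close> it therefore contributes a real b-period and no shift.\<close>
      then have ih: "i + h \<in> {1..g}" "i + h \<noteq> j" using i j assms(8) by auto
      show ?thesis
        using True period_add[OF S w[OF ij(1)] w[OF ih(1)] b[OF ij(2)]]
          conj_w[OF ij] conj_w[OF ih(1) ij(2)] ih(2)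
        by (simp only: prym_differential_def if_True complex_cnj_add)
          (simp add: unit_period_matrix_def)
    next
      case False
      then show ?thesis
        using conj_w[OF ij] by (simp add: prym_differential_def unit_period_matrix_def)
    qed
  qed
  \<comment> \<open>The shift of the period is the same in both ranges of \<open>j\<close>; the
    factor 1/2 arises because the columns beyond \<open>g\<sigma>\<close> are defined with half
    periods. Outside the rows from 1 to \<open>h\<close> all columns vanish, so the identity holds
    for functions on all indices.\<close>
  have conj_P: "cnj \<circ> P j = (\<lambda>i. P j i - (if j \<in> Ov then 0 else if j \<le> g\<sigma> then A j i else 1/2 * A j i))"
    if "j \<in> {1..h}" for j
    using conj_prym[OF _ that]
    by (auto simp: fun_eq_iff assms(17,18) column_def prym_matrix_def algebra_simps)
  show ?thesis
  proof (intro conjI ballI)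
    fix \<beta> assume "\<beta> \<in> {1..r0}"
    then show "cnj \<circ> P \<beta> = P \<beta>" using conj_P[of \<beta>] Ov[of \<beta>] h assms(13) by auto
  next
    fix j assume "j \<in> {g\<sigma>+1..g\<sigma>+r1}"
    then show "cnj \<circ> P j = P j" using conj_P[of j] Ov[of j] assms(6,7,14) by auto
  next
    fix \<beta> assume "\<beta> \<in> {r0+1..g\<sigma>}"
    then show "cnj \<circ> P \<beta> = (\<lambda>i. P \<beta> i - A \<beta> i)" using conj_P[of \<beta>] Ov[of \<beta>] h by auto
  next
    fix j assume "j \<in> {g\<sigma>+r1+1..h}"
    then show "cnj \<circ> P j = (\<lambda>i. P j i - 1/2 * A j i)" using conj_P[of j] Ov[of j] assms(13) by auto
  qed
qed

end
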